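(* Let $\tau\in\mathfrak M_{1,c}(\mathrm{Rat})$ and suppose that $J_{\ker}(G_\tau)=\emptyset$. Then $J_{meas}(\tau)=\emptyset$. Moreover, for $\tilde\tau$-a.e. $\gamma\in(\mathrm{Rat})^{\mathbb N}$, the $2$-dimensional Lebesgue measure of $J_\gamma$ is equal to zero.
   Context: $\hat{\mathbb C}$ is the Riemann sphere with spherical distance $d$. $\mathrm{Rat}$ is the set of all non-constant rational maps $\hat{\mathbb C}\to\hat{\mathbb C}$ with the metric $\kappa(f,g)=\sup_{z\in\hat{\mathbb C}}d(f(z),g(z))$. For a semigroup $G$ (under composition) of non-constant rational maps, the Fatou set $F(G)$ is the set of $z\in\hat{\mathbb C}$ having a neighborhood $U$ such that $\{g|_U\}_{g\in G}$ is equicontinuous on $U$ with respect to $d$; the Julia set is $J(G)=\hat{\mathbb C}\setminus F(G)$; the kernel Julia set is $J_{\ker}(G)=\bigcap_{g\in G}g^{-1}(J(G))$. For a topological space $X$, $\mathfrak M_1(X)$ is the space of Borel probability measures on $X$ with the topology of weak convergence (tested on bounded continuous functions), and $\mathfrak M_{1,c}(X)$ is the set of those with compact topological support. For $\tau\in\mathfrak M_{1,c}(\mathrm{Rat})$, $G_\tau$ is the semigroup generated under composition by $\operatorname{supp}\tau$, and $\tilde\tau=\otimes_{j=1}^\infty\tau$ is the product measure on $(\mathrm{Rat})^{\mathbb N}$. $C(\hat{\mathbb C})$ is the Banach space of complex-valued continuous functions on $\hat{\mathbb C}$ with the sup norm. $M_\tau:C(\hat{\mathbb C})\to C(\hat{\mathbb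 C})$ is $M_\tau(\varphi)(z)=\int\varphi(g(z))\,d\tau(g)$, and $M_\tau^*:\mathfrak M_1(\hat{\mathbb C})\to\mathfrak M_1(\hat{\mathbb C})$ is its dual, $\int\varphi\,d(M_\tau^*\mu)=\int M_\tau(\varphi)\,d\mu$. $J_{meas}(\tau)$ is the set of $\mu\in\mathfrak M_1(\hat{\mathbb C})$ such that for every neighborhood $B$ of $\mu$ in $\mathfrak M_1(\hat{\mathbb C})$ the family $\{(M_\tau^* )^n|_B:B\to\mathfrak M_1(\hat{\mathbb C})\}_{n\in\mathbb N}$ is not equicontinuous on $B$ (with respect to a metric inducing the topology of the compact metrizable space $\mathfrak M_1(\hat{\mathbb C})$). For $\gamma=(\gamma_1,\gamma_2,\dots)\in(\mathrm{Rat})^{\mathbb N}$, $J_\gamma$ is the complement of the set of points $z$ having a neighborhood on which $\{\gamma_n\circ\cdots\circ\gamma_1\}_{n\in\mathbb N}$ is equicontinuous with respect to $d$. *)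

theory Defs
  imports "HOL-Probability.Probability" "HOL-Computational_Algebra.Polynomial"
begin

section \<open>The Riemann sphere with its spherical (great-circle) distance\<close>

datatype csphere = Pt complex | Infty

text \<open>Stereographic identification with the unit sphere of \<^typ>\<open>complex \<times> real\<close>, which is
  three-dimensional Euclidean space.\<close>

fun stereo :: "csphere \<Rightarrow> complex \<times> real" where
  "stereo (Pt z) = ((2 / (1 + (cmod z)\<^sup>2)) *\<^sub>R z, ((cmod z)\<^sup>2 - 1) / ((cmod z)\<^sup>2 + 1))"
| "stereo Infty = (0, 1)"

lemma norm_stereo [simp]: "norm (stereo x) = 1"
proof (cases x)
  case (Pt z)
  have p: "1 + (cmod z)\<^sup>2 > 0" by (smt (verit) zero_le_power2)
  have "(norm (stereo x))\<^sup>2 = (2 / (1 + (cmod z)\<^sup>2) * cmod z)\<^sup>2 + (((cmod z)\<^sup>2 - 1) / ((cmod z)\<^sup>2 + 1))\<^sup>2"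
    using p by (simp add: Pt norm_Pair power_divide)
  also have "\<dots> = ((2 * cmod z)\<^sup>2 + ((cmod z)\<^sup>2 - 1)\<^sup>2) / (1 + (cmod z)\<^sup>2)\<^sup>2"
    by (simp add: power_divide power_mult_distrib add_divide_distrib add.commute)
  also have "(2 * cmod z)\<^sup>2 + ((cmod z)\<^sup>2 - 1)\<^sup>2 = (1 + (cmod z)\<^sup>2)\<^sup>2"
    by (simp add: power2_eq_square algebra_simps)
  finally have "(norm (stereo x))\<^sup>2 = 1" using p by simp
  then show ?thesis by (metis norm_ge_zero power2_eq_1_iff abs_norm_cancel abs_1 abs_minus_cancel)
qed (simp add: norm_Pair)

lemma inj_stereo: "stereo x = stereo y \<longleftrightarrow> x = y"
proof
  assume eq: "stereo x = stereo y"
  have height: "(t - 1) / (t + 1) = 1 - 2 / (1 + t)" if "t \<ge> 0" for t :: real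
    using that by (simp add: field_simps)
  show "x = y"
  proof (cases x; cases y)
    fix z w assume xy: "x = Pt z" "y = Pt w"
    have "2 / (1 + (cmod z)\<^sup>2) = 2 / (1 + (cmod w)\<^sup>2)"
      using eq xy height[of "(cmod z)\<^sup>2"] height[of "(cmod w)\<^sup>2"] by simp
    moreover have "2 / (1 + (cmod w)\<^sup>2) \<noteq> 0"
      by (smt (verit) zero_le_power2 divide_eq_0_iff)
    ultimately show ?thesis using eq xy by simp
  next
    fix z assume "x = Pt z" "y = Infty"
    then show ?thesis using eq height[of "(cmod z)\<^sup>2"] by simp
  next
    fix w assume "x = Infty" "y = Pt w"
    then show ?thesis using eq height[of "(cmod w)\<^sup>2"] by simp
  qed simp
qed simp

lemma arccos_inner_triangle:
  fixes u v w :: "'a::real_inner"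
  assumes "norm u = 1" "norm v = 1" "norm w = 1"
  shows "arccos (u \<bullet> w) \<le> arccos (u \<bullet> v) + arccos (v \<bullet> w)"
proof -
  have b: "\<bar>x \<bullet> y\<bar> \<le> 1" if "norm x = 1" "norm y = 1" for x y :: 'a
    using Cauchy_Schwarz_ineq2[of x y] that by simp
  note bs = b[OF assms(1,3)] b[OF assms(1,2)] b[OF assms(2,3)]
  let ?a = "arccos (u \<bullet> v)" and ?b = "arccos (v \<bullet> w)"
  have ab: "0 \<le> ?a" "?a \<le> pi" "0 \<le> ?b" "?b \<le> pi"
    using bs by (auto intro!: arccos_lbound arccos_ubound)
  show ?thesis
  proof (cases "?a + ?b \<le> pi")
    case True
    define p where "p = u - (u \<bullet> v) *\<^sub>R v"
    define q where "q = w - (v \<bullet> w) *\<^sub>R v"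
    have n: "u \<bullet> u = 1" "v \<bullet> v = 1" "w \<bullet> w = 1"
      using assms by (simp_all add: dot_square_norm)
    have np: "norm p = sqrt (1 - (u \<bullet> v)\<^sup>2)"
      unfolding norm_eq_sqrt_inner p_def
      by (simp add: inner_diff_left inner_diff_right n inner_commute power2_eq_square algebra_simps)
    have nq: "norm q = sqrt (1 - (v \<bullet> w)\<^sup>2)"
      unfolding norm_eq_sqrt_inner q_def
      by (simp add: inner_diff_left inner_diff_right n inner_commute power2_eq_square algebra_simps)
    have "p \<bullet> q = u \<bullet> w - (u \<bullet> v) * (v \<bullet> w)"
      unfolding p_def q_def
      by (simp add: inner_diff_left inner_diff_right n inner_commute algebra_simps)
    moreover have "- (p \<bullet> q) \<le> norm p * norm q"
      using Cauchy_Schwarz_ineq2[of p q] by linarith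
    ultimately have "cos (?a + ?b) \<le> u \<bullet> w"
      using bs by (simp add: cos_add sin_arccos_abs np nq)
    then have "arccos (u \<bullet> w) \<le> arccos (cos (?a + ?b))"
      using bs by (intro arccos_le_arccos) auto
    also have "\<dots> = ?a + ?b" using ab True by (intro arccos_cos) auto
    finally show ?thesis .
  next
    case False
    then show ?thesis using bs arccos_ubound[of "u \<bullet> w"] by linarith
  qed
qed

instantiation csphere :: metric_space
begin

definition dist_csphere :: "csphere \<Rightarrow> csphere \<Rightarrow> real" where
  "dist x y = arccos (stereo x \<bullet> stereo y)"

definition uniformity_csphere_def:
  "(uniformity :: (csphere \<times> csphere) filter) = (INF e\<in>{0<..}. principal {(x, y). dist x y < e})"

definition open_csphere_def:
  "open (U :: csphere set) \<longleftrightarrow> (\<forall>x\<in>U. \<forall>\<^sub>F (x', y) in uniformity. x' = x \<longrightarrow> y \<in> U)"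

instance
proof
  fix x y z :: csphere
  have b: "\<bar>stereo x \<bullet> stereo y\<bar> \<le> 1"
    using Cauchy_Schwarz_ineq2[of "stereo x" "stereo y"] by simp
  show "dist x y = 0 \<longleftrightarrow> x = y"
  proof
    assume "dist x y = 0"
    then have "stereo x \<bullet> stereo y = 1"
      using b unfolding dist_csphere_def by (metis abs_le_iff arccos_1 arccos_eq_iff abs_1 order_refl)
    then have "stereo x = stereo y"
      using norm_cauchy_schwarz_eq[of "stereo x" "stereo y"] by simp
    then show "x = y" by (simp add: inj_stereo)
  next
    assume "x = y"
    then show "dist x y = 0" by (simp add: dist_csphere_def dot_square_norm)
  qed
  show "dist x y \<le> dist x z + dist y z"
    unfolding dist_csphere_def
    using arccos_inner_triangle[of "stereo x" "stereo z" "stereo y"] by (simp add: inner_commute)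
qed (simp_all add: uniformity_csphere_def open_csphere_def)

end

lemma dist_csphere_le_pi: "dist (x :: csphere) y \<le> pi"
proof -
  have "\<bar>stereo x \<bullet> stereo y\<bar> \<le> 1"
    using Cauchy_Schwarz_ineq2[of "stereo x" "stereo y"] by simp
  then show ?thesis unfolding dist_csphere_def by (intro arccos_ubound) auto
qed

lemma stereo_surj:
  assumes "norm v = 1"
  shows "\<exists>x. stereo x = v"
proof (cases "snd v = 1")
  case True
  have "(cmod (fst v))\<^sup>2 + (snd v)\<^sup>2 = 1"
    using assms by (metis norm_Pair prod.collapse real_sqrt_eq_1_iff real_norm_def power2_abs)
  then have "fst v = 0" using True by simp
  then have "stereo Infty = v" using True by (simp add: prod_eq_iff)
  then show ?thesis by blast
next
  case False
  define t where "t = snd v"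
  define z where "z = (1 / (1 - t)) *\<^sub>R fst v"
  have e: "(cmod (fst v))\<^sup>2 + t\<^sup>2 = 1"
    using assms unfolding t_def by (metis norm_Pair prod.collapse real_sqrt_eq_1_iff real_norm_def power2_abs)
  have t: "1 - t \<noteq> 0" using False by (simp add: t_def)
  have "(cmod z)\<^sup>2 = (cmod (fst v))\<^sup>2 / (1 - t)\<^sup>2"
    by (simp add: z_def power_divide)
  also have "\<dots> = ((1 + t) * (1 - t)) / (1 - t)\<^sup>2"
    using e by (simp add: power2_eq_square algebra_simps)
  also have "\<dots> = (1 + t) / (1 - t)" using t by (simp add: power2_eq_square)
  finally have z: "(cmod z)\<^sup>2 = (1 + t) / (1 - t)" .
  have "1 + (cmod z)\<^sup>2 = 2 / (1 - t)" "(cmod z)\<^sup>2 - 1 = 2 * t / (1 - t)"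
    using t unfolding z by (simp_all add: field_simps)
  then have "stereo (Pt z) = v"
    using t by (simp add: prod_eq_iff z_def t_def add.commute)
  then show ?thesis by blast
qed

lemma compact_csphere: "compact (UNIV :: csphere set)"
  unfolding compact_eq_seq_compact_metric seq_compact_def
proof (intro allI impI)
  fix f :: "nat \<Rightarrow> csphere"
  have "seq_compact (sphere (0 :: complex \<times> real) 1)"
    using compact_sphere compact_eq_seq_compact_metric by blast
  then obtain v r where v: "v \<in> sphere 0 1" "strict_mono r" "((\<lambda>n. stereo (f n)) \<circ> r) \<longlonglongrightarrow> v"
    unfolding seq_compact_def by (metis dist_0_norm mem_sphere norm_stereo)
  then obtain x where x: "stereo x = v" using stereo_surj by fastforce
  have "(\<lambda>n. dist (f (r n)) x) \<longlonglongrightarrow> arccos (v \<bullet> v)"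
    unfolding dist_csphere_def x
  proof (rule continuous_on_tendsto_compose[OF continuous_on_arccos'])
    show "(\<lambda>n. stereo (f (r n)) \<bullet> v) \<longlonglongrightarrow> v \<bullet> v"
      using v(3) by (intro tendsto_intros) (simp add: o_def)
    show "v \<bullet> v \<in> {-1..1}" using v(1) by (simp add: dot_square_norm)
    have "\<bar>stereo y \<bullet> v\<bar> \<le> 1" for y
      using Cauchy_Schwarz_ineq2[of "stereo y" v] v(1) by simp
    then show "\<forall>\<^sub>F n in sequentially. stereo (f (r n)) \<bullet> v \<in> {-1..1}"
      by (intro always_eventually) (auto simp: abs_le_iff minus_le_iff)
  qed
  then have "(f \<circ> r) \<longlonglongrightarrow> x"
    using v(1) by (subst tendsto_dist_iff) (simp add: dot_square_norm o_def)
  then show "\<exists>l\<in>UNIV. \<exists>r. strict_mono r \<and> (f \<circ> r) \<longlonglongrightarrow> l"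
    using v(2) by blast
qed


section \<open>Non-constant rational maps\<close>

definition sphere_quot :: "complex \<Rightarrow> complex \<Rightarrow> csphere" where
  "sphere_quot a b = (if b = 0 then Infty else Pt (a / b))"

text \<open>The map \<open>p / q\<close>, for coprime \<open>p\<close> and \<open>q\<close>.  Its value at infinity is read off from the leading
  homogeneous part: with \<open>d\<close> the larger of the two degrees, it is the quotient of the \<open>d\<close>-th
  coefficients.\<close>

fun rational_fun :: "complex poly \<Rightarrow> complex poly \<Rightarrow> csphere \<Rightarrow> csphere" where
  "rational_fun p q (Pt z) = sphere_quot (poly p z) (poly q z)"
| "rational_fun p q Infty =
     (let d = max (degree p) (degree q) in sphere_quot (coeff p d) (coeff q d))"

typedef ratmap = "{f. (\<exists>p q. coprime p q \<and> f = rational_fun p q) \<and> \<not> f constant_on UNIV}"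
  morphisms rapply Abs_ratmap
proof -
  have "rational_fun [:0, 1:] 1 (Pt 0) \<noteq> rational_fun [:0, 1:] 1 (Pt 1)"
    by (simp add: sphere_quot_def)
  then have "\<not> rational_fun [:0, 1:] 1 constant_on UNIV"
    unfolding constant_on_def by (metis UNIV_I)
  moreover have "\<exists>p q. coprime p q \<and> rational_fun [:0, 1:] 1 = rational_fun p q"
    by (intro exI[of _ "[:0, 1:]"] exI[of _ 1]) simp
  ultimately show ?thesis by blast
qed

instantiation ratmap :: metric_space
begin

definition dist_ratmap :: "ratmap \<Rightarrow> ratmap \<Rightarrow> real" where
  "dist f g = (SUP z. dist (rapply f z) (rapply g z))"

definition uniformity_ratmap_def:
  "(uniformity :: (ratmap \<times> ratmap) filter) = (INF e\<in>{0<..}. principal {(x, y). dist x y < e})"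

definition open_ratmap_def:
  "open (U :: ratmap set) \<longleftrightarrow> (\<forall>x\<in>U. \<forall>\<^sub>F (x', y) in uniformity. x' = x \<longrightarrow> y \<in> U)"

instance
proof
  fix f g h :: ratmap
  have bdd: "bdd_above (range (\<lambda>z. dist (rapply f z) (rapply g z)))" for f g :: ratmap
    by (auto intro!: bdd_aboveI[of _ pi] dist_csphere_le_pi)
  have le: "dist (rapply f z) (rapply g z) \<le> dist f g" for f g z
    unfolding dist_ratmap_def by (intro cSUP_upper bdd) auto
  show "dist f g = 0 \<longleftrightarrow> f = g"
  proof
    assume "dist f g = 0"
    then have "rapply f z = rapply g z" for z using le[of f z g] by simp
    then show "f = g" by (simp add: rapply_inject[symmetric] fun_eq_iff)
  qed (simp add: dist_ratmap_def)
  show "dist f g \<le> dist f h + dist g h"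
    unfolding dist_ratmap_def[of f g]
  proof (rule cSUP_least)
    fix z
    have "dist (rapply f z) (rapply g z) \<le> dist (rapply f z) (rapply h z) + dist (rapply g z) (rapply h z)"
      by (rule dist_triangle2)
    then show "dist (rapply f z) (rapply g z) \<le> dist f h + dist g h"
      using le[of f z h] le[of g z h] by linarith
  qed simp
qed (simp_all add: uniformity_ratmap_def open_ratmap_def)

end


section \<open>Equicontinuity, Fatou and Julia sets\<close>

definition equicontinuous_on ::
  "('a \<Rightarrow> 'a \<Rightarrow> real) \<Rightarrow> ('b \<Rightarrow> 'b \<Rightarrow> real) \<Rightarrow> 'a set \<Rightarrow> ('a \<Rightarrow> 'b) set \<Rightarrow> bool" where
  "equicontinuous_on d1 d2 U F \<longleftrightarrow>
     (\<forall>x\<in>U. \<forall>e>0. \<exists>\<delta>>0. \<forall>f\<in>F. \<forall>y\<in>U. d1 x y < \<delta> \<longrightarrow> d2 (f x) (f y) < e)"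

definition fatou_set :: "(csphere \<Rightarrow> csphere) set \<Rightarrow> csphere set" where
  "fatou_set F = {z. \<exists>U. open U \<and> z \<in> U \<and> equicontinuous_on dist dist U F}"

definition julia_set :: "(csphere \<Rightarrow> csphere) set \<Rightarrow> csphere set" where
  "julia_set F = - fatou_set F"

definition kernel_julia_set :: "(csphere \<Rightarrow> csphere) set \<Rightarrow> csphere set" where
  "kernel_julia_set G = (\<Inter>g\<in>G. g -` julia_set G)"

inductive_set generated_semigroup :: "('a \<Rightarrow> 'a) set \<Rightarrow> ('a \<Rightarrow> 'a) set"
  for S :: "('a \<Rightarrow> 'a) set" where
  gen: "f \<in> S \<Longrightarrow> f \<in> generated_semigroup S"
| comp: "f \<in> generated_semigroup S \<Longrightarrow> g \<in> generated_semigroup S \<Longrightarrow> f \<circ> g \<in> generated_semigroup S"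

text \<open>Sequences are indexed from \<open>0\<close>, so \<open>random_comp \<gamma> n\<close> is the composition of the first \<open>n + 1\<close>
  maps, the map \<open>\<gamma> 0\<close> being applied first.\<close>

primrec random_comp :: "(nat \<Rightarrow> ratmap) \<Rightarrow> nat \<Rightarrow> csphere \<Rightarrow> csphere" where
  "random_comp \<gamma> 0 = rapply (\<gamma> 0)"
| "random_comp \<gamma> (Suc n) = rapply (\<gamma> (Suc n)) \<circ> random_comp \<gamma> n"

definition random_julia_set :: "(nat \<Rightarrow> ratmap) \<Rightarrow> csphere set" where
  "random_julia_set \<gamma> = julia_set (range (random_comp \<gamma>))"


section \<open>Borel probability measures\<close>

definition borel_probs :: "'a::topological_space measure set" where
  "borel_probs = {\<mu>. prob_space \<mu> \<and> sets \<mu> = sets borel}"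

definition weak_topology :: "'a::topological_space measure topology" where
  "weak_topology = topology_generated_by
     {{\<mu> \<in> borel_probs. (\<integral>x. \<phi> x \<partial>\<mu>) \<in> W} | (\<phi> :: 'a \<Rightarrow> real) W.
        continuous_on UNIV \<phi> \<and> bounded (range \<phi>) \<and> open W}"

lemma topspace_weak_topology [simp]: "topspace weak_topology = (borel_probs :: 'a::topological_space measure set)"
proof -
  have "(borel_probs :: 'a measure set) \<in> {{\<mu> \<in> borel_probs. (\<integral>x. \<phi> x \<partial>\<mu>) \<in> W} | (\<phi> :: 'a \<Rightarrow> real) W.
        continuous_on UNIV \<phi> \<and> bounded (range \<phi>) \<and> open W}"
    by (rule CollectI, rule exI[of _ "\<lambda>_. 0"], rule exI[of _ UNIV]) auto
  then show ?thesis unfolding weak_topology_def topology_generated_by_topspace by blast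
qed

lemma integrable_borel_probs:
  fixes \<phi> :: "'a::topological_space \<Rightarrow> 'b::{banach, second_countable_topology}"
  assumes "\<mu> \<in> borel_probs" "continuous_on UNIV \<phi>" "bounded (range \<phi>)"
  shows "integrable \<mu> \<phi>"
proof -
  interpret prob_space \<mu> using assms(1) by (simp add: borel_probs_def)
  have m: "\<phi> \<in> borel_measurable \<mu>"
    using assms(1) borel_measurable_continuous_onI[OF assms(2)]
    by (simp add: borel_probs_def cong: measurable_cong_sets)
  obtain B where "\<And>x. norm (\<phi> x) \<le> B"
    using assms(3) unfolding bounded_iff by auto
  then show ?thesis by (intro integrable_const_bound[of _ B] m) auto
qed

lemma borel_probs_eqI:
  fixes \<mu> \<nu> :: "'a::metric_space measure"
  assumes \<mu>: "\<mu> \<in> borel_probs" and \<nu>: "\<nu> \<in> borel_probs"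
    and eq: "\<And>\<phi> :: 'a \<Rightarrow> real. continuous_on UNIV \<phi> \<Longrightarrow> bounded (range \<phi>) \<Longrightarrow>
      (\<integral>x. \<phi> x \<partial>\<mu>) = (\<integral>x. \<phi> x \<partial>\<nu>)"
  shows "\<mu> = \<nu>"
proof (rule measure_eqI_generator_eq[where E = "{S. open S}" and \<Omega> = UNIV and A = "\<lambda>_. UNIV"])
  show "sets \<mu> = sigma_sets UNIV {S. open S}" "sets \<nu> = sigma_sets UNIV {S. open S}"
    using assms(1,2) by (auto simp: borel_probs_def borel_def)
  interpret M: prob_space \<mu> using \<mu> by (simp add: borel_probs_def)
  interpret N: prob_space \<nu> using \<nu> by (simp add: borel_probs_def)
  have sp: "space \<mu> = UNIV" "space \<nu> = UNIV"
    using \<mu> \<nu> sets_eq_imp_space_eq[of _ borel] by (auto simp: borel_probs_def)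
  show "emeasure \<mu> UNIV \<noteq> \<infinity>" using M.emeasure_space_1 sp by simp
  fix S :: "'a set" assume "S \<in> {S. open S}"
  then have S: "open S" by simp
  show "emeasure \<mu> S = emeasure \<nu> S"
  proof (cases "S = UNIV")
    case True
    then show ?thesis using M.emeasure_space_1 N.emeasure_space_1 sp by simp
  next
    case False
    define f where "f n x = min 1 (real n * infdist x (- S))" for n x
    have cf: "continuous_on UNIV (f n)" for n
      unfolding f_def by (intro continuous_intros)
    have bf: "norm (f n x) \<le> 1" for n x
    proof -
      have "0 \<le> real n * infdist x (- S)" by (intro mult_nonneg_nonneg infdist_nonneg) simp
      then show ?thesis unfolding f_def by (simp only: real_norm_def)
    qed
    then have bf': "bounded (range (f n))" for n unfolding bounded_iff by blast
    have lim: "(\<lambda>n. f n x) \<longlonglongrightarrow> indicator S x" for x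
    proof (cases "x \<in> S")
      case True
      then have "infdist x (- S) > 0"
        using S False by (subst infdist_pos_not_in_closed) auto
      then obtain N :: nat where N: "1 / infdist x (- S) \<le> real N" using real_arch_simple by blast
      have "f n x = 1" if "n \<ge> N" for n
      proof -
        have "1 / infdist x (- S) \<le> real n" using N that by linarith
        then show ?thesis using \<open>infdist x (- S) > 0\<close> by (simp add: f_def field_simps)
      qed
      then show ?thesis using True by (intro tendsto_eventually) (auto simp: eventually_sequentially)
    qed (simp add: f_def)
    have conv: "(\<lambda>n. \<integral>x. f n x \<partial>\<kappa>) \<longlonglongrightarrow> measure \<kappa> S" if "\<kappa> \<in> borel_probs" for \<kappa> :: "'a measure"
    proof -
      interpret K: prob_space \<kappa> using that by (simp add: borel_probs_def)
      have "S \<in> sets \<kappa>" using that S by (simp add: borel_probs_def)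
      moreover have "(\<lambda>n. \<integral>x. f n x \<partial>\<kappa>) \<longlonglongrightarrow> (\<integral>x. indicator S x \<partial>\<kappa>)"
        using lim bf integrable_borel_probs[OF that cf bf'] \<open>S \<in> sets \<kappa>\<close>
        by (intro integral_dominated_convergence[where w = "\<lambda>_. 1"]) auto
      ultimately show ?thesis by simp
    qed
    have "measure \<mu> S = measure \<nu> S"
      using conv[OF \<mu>] conv[OF \<nu>] eq[OF cf bf'] by (auto intro: LIMSEQ_unique)
    then show ?thesis by (simp add: M.emeasure_eq_measure N.emeasure_eq_measure)
  qed
qed (auto simp: Int_stable_def)

lemma countable_approximating_family:
  assumes "compact (UNIV :: 'a::metric_space set)"
  obtains H :: "('a::metric_space \<Rightarrow> real) set" where "countable H" "\<And>h. h \<in> H \<Longrightarrow> continuous_on UNIV h"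
    "\<And>\<phi> e. continuous_on UNIV \<phi> \<Longrightarrow> e > 0 \<Longrightarrow>
       \<exists>K c. finite K \<and> K \<subseteq> H \<and> (\<forall>x. \<bar>\<phi> x - (\<Sum>h\<in>K. c h * h x)\<bar> < e)"
proof -
  have "\<exists>X. finite X \<and> (UNIV :: 'a set) \<subseteq> (\<Union>a\<in>X. ball a (1 / real (Suc n)))" for n
    using assms unfolding compact_eq_totally_bounded by simp
  then obtain X :: "nat \<Rightarrow> 'a set"
    where X: "\<And>n. finite (X n)" "\<And>n. UNIV \<subseteq> (\<Union>a\<in>X n. ball a (1 / real (Suc n)))"
    by metis
  define g where "g n a x = max 0 (1 / real (Suc n) - dist x a)" for n and a x :: 'a
  define s where "s n x = (\<Sum>b\<in>X n. g n b x)" for n x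
  define h where "h n a x = g n a x / s n x" for n a x
  have g0: "g n a x \<ge> 0" for n a x by (simp add: g_def)
  have s0: "s n x > 0" for n x
  proof -
    have "x \<in> (\<Union>a\<in>X n. ball a (1 / real (Suc n)))" using X(2) by blast
    then obtain a where "a \<in> X n" "dist x a < 1 / real (Suc n)"
      by (auto simp: dist_commute)
    then show ?thesis
      unfolding s_def by (intro sum_pos2[OF X(1) \<open>a \<in> X n\<close>] g0) (auto simp: g_def)
  qed
  have ch: "continuous_on UNIV (h n a)" for n a
  proof -
    have "continuous_on UNIV (g n b)" for b unfolding g_def by (intro continuous_intros)
    then show ?thesis using s0[of n] unfolding h_def s_def
      by (intro continuous_intros) (auto simp: less_imp_neq[symmetric])
  qed
  show thesis
  proof (rule that[of "\<Union>n. h n ` X n"])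
    show "countable (\<Union>n. h n ` X n)" using X(1) by (auto intro: countable_finite)
    show "continuous_on UNIV f" if "f \<in> (\<Union>n. h n ` X n)" for f using that ch by auto
    fix \<phi> :: "'a \<Rightarrow> real" and e :: real assume \<phi>: "continuous_on UNIV \<phi>" and e: "e > 0"
    have "uniformly_continuous_on UNIV \<phi>" by (rule compact_uniformly_continuous[OF \<phi> assms])
    then obtain d where d: "d > 0" "\<And>x y. dist x y < d \<Longrightarrow> dist (\<phi> x) (\<phi> y) < e"
      unfolding uniformly_continuous_on_def using e by (metis UNIV_I)
    obtain n where n: "1 / real (Suc n) < d" using nat_approx_posE[OF d(1)] .
    define c where "c f = (\<Sum>a\<in>{a \<in> X n. h n a = f}. \<phi> a)" for f
    have "\<bar>\<phi> x - (\<Sum>f\<in>h n ` X n. c f * f x)\<bar> < e" for x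
    proof -
      have "(\<Sum>f\<in>h n ` X n. c f * f x) = (\<Sum>f\<in>h n ` X n. \<Sum>a\<in>{a \<in> X n. h n a = f}. \<phi> a * h n a x)"
        by (auto intro!: sum.cong simp: c_def sum_distrib_right)
      also have "\<dots> = (\<Sum>a\<in>X n. \<phi> a * h n a x)"
        by (rule sum.image_gen[OF X(1), symmetric])
      finally have 1: "(\<Sum>f\<in>h n ` X n. c f * f x) = (\<Sum>a\<in>X n. \<phi> a * h n a x)" .
      have 2: "(\<Sum>a\<in>X n. h n a x) = 1"
        using s0[of n x] by (simp add: h_def sum_divide_distrib[symmetric] s_def)
      have "\<phi> x = (\<Sum>a\<in>X n. \<phi> x * h n a x)" by (simp add: sum_distrib_left[symmetric] 2)
      then have "\<bar>\<phi> x - (\<Sum>f\<in>h n ` X n. c f * f x)\<bar> = \<bar>\<Sum>a\<in>X n. (\<phi> x - \<phi> a) * h n a x\<bar>"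
        unfolding 1 by (simp add: left_diff_distrib sum_subtractf)
      also have "\<dots> \<le> (\<Sum>a\<in>X n. \<bar>(\<phi> x - \<phi> a) * h n a x\<bar>)" by (rule sum_abs)
      also have "\<dots> < (\<Sum>a\<in>X n. e * h n a x)"
      proof (rule sum_strict_mono_ex1[OF X(1)])
        have near: "\<bar>\<phi> x - \<phi> a\<bar> < e" if "h n a x \<noteq> 0" for a
        proof -
          have "dist x a < d" using that n by (auto simp: h_def g_def max_def split: if_splits)
          then show ?thesis using d(2) by (simp add: dist_real_def)
        qed
        have h0: "h n a x \<ge> 0" for a using g0 s0[of n x] by (simp add: h_def)
        show "\<forall>a\<in>X n. \<bar>(\<phi> x - \<phi> a) * h n a x\<bar> \<le> e * h n a x"
        proof
          fix a assume "a \<in> X n"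
          show "\<bar>(\<phi> x - \<phi> a) * h n a x\<bar> \<le> e * h n a x"
          proof (cases "h n a x = 0")
            case False
            then show ?thesis
              using near[OF False] h0[of a] by (simp add: abs_mult mult_right_mono less_imp_le)
          qed simp
        qed
        obtain a where "a \<in> X n" "h n a x \<noteq> 0"
          using 2 by (metis sum.neutral zero_neq_one)
        then show "\<exists>a\<in>X n. \<bar>(\<phi> x - \<phi> a) * h n a x\<bar> < e * h n a x"
          using near[of a] h0[of a]
          by (intro bexI[of _ a]) (simp_all add: abs_mult mult_strict_right_mono)
      qed
      also have "\<dots> = e" by (simp add: sum_distrib_left[symmetric] 2)
      finally show ?thesis .
    qed
    then show "\<exists>K c. finite K \<and> K \<subseteq> (\<Union>n. h n ` X n) \<and> (\<forall>x. \<bar>\<phi> x - (\<Sum>h\<in>K. c h * h x)\<bar> < e)"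
      using X(1) by (intro exI[of _ "h n ` X n"] exI[of _ c]) auto
  qed
qed

lemma metrizable_weak_topology:
  assumes "compact (UNIV :: 'a::metric_space set)"
  shows "metrizable_space (weak_topology :: 'a::metric_space measure topology)"
proof -
  obtain H :: "('a \<Rightarrow> real) set" where H: "countable H" "\<And>h. h \<in> H \<Longrightarrow> continuous_on UNIV h"
    and approx: "\<And>\<phi> e. continuous_on UNIV \<phi> \<Longrightarrow> e > 0 \<Longrightarrow>
       \<exists>K c. finite K \<and> K \<subseteq> H \<and> (\<forall>x. \<bar>\<phi> x - (\<Sum>h\<in>K. c h * h x)\<bar> < e)"
    using countable_approximating_family[OF assms] by blast
  have bdd: "bounded (range \<phi>)" if "continuous_on UNIV \<phi>" for \<phi> :: "'a \<Rightarrow> real"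
    using compact_continuous_image[OF that assms] compact_imp_bounded by blast
  have int: "integrable \<mu> \<phi>" if "\<mu> \<in> borel_probs" "continuous_on UNIV \<phi>" for \<mu> and \<phi> :: "'a \<Rightarrow> real"
    using integrable_borel_probs[OF that bdd[OF that(2)]] .
  define I where "I \<mu> = (\<lambda>h\<in>H. \<integral>x. h x \<partial>\<mu>)" for \<mu> :: "'a measure"
  let ?P = "product_topology (\<lambda>_. euclideanreal) H"
  let ?T = "subtopology ?P (I ` borel_probs)"
  have app_int: "\<exists>K c. finite K \<and> K \<subseteq> H \<and>
      (\<forall>\<mu>\<in>borel_probs. \<bar>(\<integral>x. \<phi> x \<partial>\<mu>) - (\<Sum>h\<in>K. c h * I \<mu> h)\<bar> < e)"
    if \<phi>: "continuous_on UNIV \<phi>" and e: "e > 0" for \<phi> e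
  proof -
    obtain K c where K: "finite K" "K \<subseteq> H" "\<And>x. \<bar>\<phi> x - (\<Sum>h\<in>K. c h * h x)\<bar> < e / 2"
      using approx[OF \<phi>, of "e / 2"] e by auto
    have "\<bar>(\<integral>x. \<phi> x \<partial>\<mu>) - (\<Sum>h\<in>K. c h * I \<mu> h)\<bar> < e" if \<mu>: "\<mu> \<in> borel_probs" for \<mu>
    proof -
      interpret prob_space \<mu> using \<mu> by (simp add: borel_probs_def)
      have ih: "integrable \<mu> h" if "h \<in> K" for h using int[OF \<mu>] H(2) K(2) that by blast
      have isum: "integrable \<mu> (\<lambda>x. \<Sum>h\<in>K. c h * h x)" using ih by auto
      have "(\<Sum>h\<in>K. c h * I \<mu> h) = (\<Sum>h\<in>K. \<integral>x. c h * h x \<partial>\<mu>)"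
        using K(2) by (intro sum.cong) (auto simp: I_def)
      also have "\<dots> = (\<integral>x. (\<Sum>h\<in>K. c h * h x) \<partial>\<mu>)"
        using ih by (intro Bochner_Integration.integral_sum[symmetric]) auto
      finally have "(\<integral>x. \<phi> x \<partial>\<mu>) - (\<Sum>h\<in>K. c h * I \<mu> h) = (\<integral>x. \<phi> x - (\<Sum>h\<in>K. c h * h x) \<partial>\<mu>)"
        using int[OF \<mu> \<phi>] isum by simp
      also have "\<bar>\<dots>\<bar> \<le> (\<integral>x. \<bar>\<phi> x - (\<Sum>h\<in>K. c h * h x)\<bar> \<partial>\<mu>)"
        using integral_abs_bound by blast
      also have "\<dots> \<le> (\<integral>x. e / 2 \<partial>\<mu>)"
        using int[OF \<mu> \<phi>] isum K(3) by (intro integral_mono) (auto intro: less_imp_le)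
      also have "\<dots> < e" using e by (simp add: prob_space)
      finally show ?thesis .
    qed
    then show ?thesis using K by blast
  qed
  have inj: "inj_on I borel_probs"
  proof (rule inj_onI)
    fix \<mu> \<nu> :: "'a measure" assume \<mu>\<nu>: "\<mu> \<in> borel_probs" "\<nu> \<in> borel_probs" "I \<mu> = I \<nu>"
    show "\<mu> = \<nu>"
    proof (rule borel_probs_eqI[OF \<mu>\<nu>(1,2)])
      fix \<phi> :: "'a \<Rightarrow> real" assume \<phi>: "continuous_on UNIV \<phi>"
      have "\<bar>(\<integral>x. \<phi> x \<partial>\<mu>) - (\<integral>x. \<phi> x \<partial>\<nu>)\<bar> \<le> 0 + e" if e: "e > 0" for e
      proof -
        obtain K c where "\<And>\<kappa>. \<kappa> \<in> borel_probs \<Longrightarrow> \<bar>(\<integral>x. \<phi> x \<partial>\<kappa>) - (\<Sum>h\<in>K. c h * I \<kappa> h)\<bar> < e / 2"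
          using app_int[OF \<phi>, of "e / 2"] e by (metis half_gt_zero)
        from this[OF \<mu>\<nu>(1)] this[OF \<mu>\<nu>(2)] show ?thesis unfolding \<mu>\<nu>(3) by linarith
      qed
      then have "\<bar>(\<integral>x. \<phi> x \<partial>\<mu>) - (\<integral>x. \<phi> x \<partial>\<nu>)\<bar> \<le> 0" by (rule field_le_epsilon)
      then show "(\<integral>x. \<phi> x \<partial>\<mu>) = (\<integral>x. \<phi> x \<partial>\<nu>)" by simp
    qed
  qed
  have sub: "openin weak_topology {\<mu> \<in> borel_probs. (\<integral>x. \<phi> x \<partial>\<mu>) \<in> W}"
    if "continuous_on UNIV \<phi>" "open W" for \<phi> :: "'a \<Rightarrow> real" and W
    unfolding weak_topology_def using that bdd[OF that(1)]
    by (intro topology_generated_by_Basis) blast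
  have fwd: "continuous_map weak_topology ?T I"
  proof (rule continuous_map_into_subtopology)
    show "I \<in> topspace weak_topology \<rightarrow> I ` borel_probs" by auto
    show "continuous_map weak_topology ?P I"
      unfolding continuous_map_componentwise
    proof (intro conjI ballI)
      show "I ` topspace weak_topology \<subseteq> extensional H" by (auto simp: I_def)
      fix h assume "h \<in> H"
      then show "continuous_map weak_topology euclideanreal (\<lambda>\<mu>. I \<mu> h)"
        using sub[OF H(2)] by (auto simp: continuous_map_def I_def)
    qed
  qed
  have T: "topspace ?T = I ` borel_probs" by (auto simp: I_def)
  have bwd: "continuous_map ?T weak_topology (inv_into borel_probs I)"
    unfolding weak_topology_def
  proof (rule continuous_on_generated_topo, goal_cases)
    case (1 U)
    then obtain \<phi> :: "'a \<Rightarrow> real" and W where U: "U = {\<mu> \<in> borel_probs. (\<integral>x. \<phi> x \<partial>\<mu>) \<in> W}"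
      and \<phi>: "continuous_on UNIV \<phi>" and W: "open W" by blast
    let ?F = "\<lambda>y. \<integral>x. \<phi> x \<partial>(inv_into borel_probs I y)"
    have "continuous_map ?T Met_TC.mtopology ?F"
      unfolding Met_TC.continuous_map_to_metric
    proof (intro ballI allI impI)
      fix y and e :: real assume y: "y \<in> topspace ?T" and e: "e > 0"
      obtain K c where K: "finite K" "K \<subseteq> H"
        "\<And>\<kappa>. \<kappa> \<in> borel_probs \<Longrightarrow> \<bar>(\<integral>x. \<phi> x \<partial>\<kappa>) - (\<Sum>h\<in>K. c h * I \<kappa> h)\<bar> < e / 3"
        using app_int[OF \<phi>, of "e / 3"] e by (metis divide_pos_pos zero_less_numeral)
      let ?G = "\<lambda>y. \<Sum>h\<in>K. c h * y h"
      have near: "\<bar>?F z - ?G z\<bar> < e / 3" if "z \<in> topspace ?T" for z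
        using K(3)[of "inv_into borel_probs I z"] that
        unfolding T by (simp add: inv_into_into f_inv_into_f)
      have "continuous_map ?T euclideanreal ?G"
        using K(1,2) by (intro continuous_intros) auto
      then have "continuous_map ?T Met_TC.mtopology ?G" by simp
      moreover have "e / 3 > 0" using e by simp
      ultimately obtain V where V: "openin ?T V" "y \<in> V" "\<forall>z\<in>V. ?G z \<in> Met_TC.mball (?G y) (e / 3)"
        unfolding Met_TC.continuous_map_to_metric using y by blast
      have "?F z \<in> Met_TC.mball (?F y) e" if "z \<in> V" for z
      proof -
        have "z \<in> topspace ?T" using V(1) that openin_subset by blast
        moreover have "\<bar>?G y - ?G z\<bar> < e / 3" using V(3) that by (simp add: dist_real_def)
        ultimately have "\<bar>?F y - ?F z\<bar> < e" using near[of z] near[OF y] by linarith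
        then show ?thesis by (simp add: dist_real_def)
      qed
      then show "\<exists>U. openin ?T U \<and> y \<in> U \<and> (\<forall>z\<in>U. ?F z \<in> Met_TC.mball (?F y) e)"
        using V by blast
    qed
    then have "openin ?T {y \<in> topspace ?T. ?F y \<in> W}"
      using W by (simp add: continuous_map_def)
    also have "{y \<in> topspace ?T. ?F y \<in> W} = inv_into borel_probs I -` U \<inter> topspace ?T"
      unfolding T U by (auto simp: inv_into_into)
    finally show ?case .
  next
    case 2
    show ?case
      using topspace_weak_topology[where 'a = 'a]
      unfolding T weak_topology_def topology_generated_by_topspace
      by (auto simp: inv_into_into)
  qed
  have "homeomorphic_maps weak_topology ?T I (inv_into borel_probs I)"
    unfolding homeomorphic_maps_def T
    using fwd bwd inj by (auto simp: f_inv_into_f)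
  then have "(weak_topology :: 'a measure topology) homeomorphic_space ?T"
    by (rule homeomorphic_maps_imp_homeomorphic_space)
  moreover have "metrizable_space ?P"
    using H(1) by (auto simp: metrizable_space_product_topology metrizable_space_euclidean
        intro: countable_subset[of _ H])
  then have "metrizable_space ?T" by (rule metrizable_space_subtopology)
  ultimately show ?thesis by (simp add: homeomorphic_metrizable_space)
qed

definition measure_support :: "'a::topological_space measure \<Rightarrow> 'a set" where
  "measure_support \<mu> = {x. \<forall>U. open U \<and> x \<in> U \<longrightarrow> emeasure \<mu> U > 0}"

definition compact_borel_probs :: "'a::topological_space measure set" where
  "compact_borel_probs = {\<mu> \<in> borel_probs. compact (measure_support \<mu>)}"

definition semigroup_of :: "ratmap measure \<Rightarrow> (csphere \<Rightarrow> csphere) set" where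
  "semigroup_of \<tau> = generated_semigroup (rapply ` measure_support \<tau>)"

definition seq_measure :: "'a measure \<Rightarrow> (nat \<Rightarrow> 'a) measure" where
  "seq_measure \<tau> = PiM UNIV (\<lambda>_. \<tau>)"

text \<open>Spherical area, written in the affine chart; the point at infinity is a null set.\<close>

definition sphere_lebesgue :: "csphere measure" where
  "sphere_lebesgue = distr (density lborel (\<lambda>z. ennreal (4 / (1 + (cmod z)\<^sup>2)\<^sup>2))) borel Pt"


section \<open>The transition operator and its dual\<close>

definition transition_op :: "ratmap measure \<Rightarrow> (csphere \<Rightarrow> complex) \<Rightarrow> csphere \<Rightarrow> complex" where
  "transition_op \<tau> \<phi> z = (\<integral>g. \<phi> (rapply g z) \<partial>\<tau>)"

text \<open>By the Riesz representation theorem there is exactly one such \<open>\<nu>\<close> whenever \<open>\<tau>\<close> and \<open>\<mu>\<close> are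
  Borel probability measures.\<close>

definition dual_transition_op :: "ratmap measure \<Rightarrow> csphere measure \<Rightarrow> csphere measure" where
  "dual_transition_op \<tau> \<mu> = (THE \<nu>. \<nu> \<in> borel_probs \<and>
     (\<forall>\<phi>. continuous_on UNIV \<phi> \<longrightarrow> (\<integral>z. \<phi> z \<partial>\<nu>) = (\<integral>z. transition_op \<tau> \<phi> z \<partial>\<mu>)))"

text \<open>The space of Borel probability measures on the sphere is compact, so equicontinuity does not
  depend on which compatible metric is used; the metric is therefore kept as a parameter.
  Lemma \<open>ex_weak_metric\<close> shows that compatible metrics exist.\<close>

definition weak_metric :: "(csphere measure \<Rightarrow> csphere measure \<Rightarrow> real) \<Rightarrow> bool" where
  "weak_metric \<rho> \<longleftrightarrow>
     Metric_space borel_probs \<rho> \<and> Metric_space.mtopology borel_probs \<rho> = weak_topology"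

lemma ex_weak_metric: "\<exists>\<rho>. weak_metric \<rho>"
proof -
  obtain M \<rho> where "Metric_space M \<rho>" "(weak_topology :: csphere measure topology) = Metric_space.mtopology M \<rho>"
    using metrizable_weak_topology[OF compact_csphere] unfolding metrizable_space_def by blast
  moreover from this have "M = borel_probs"
    by (metis Metric_space.topspace_mtopology topspace_weak_topology)
  ultimately show ?thesis unfolding weak_metric_def by metis
qed

definition julia_meas ::
  "(csphere measure \<Rightarrow> csphere measure \<Rightarrow> real) \<Rightarrow> ratmap measure \<Rightarrow> csphere measure set" where
  "julia_meas \<rho> \<tau> = {\<mu> \<in> borel_probs. \<forall>B. openin weak_topology B \<and> \<mu> \<in> B \<longrightarrow>
     \<not> equicontinuous_on \<rho> \<rho> B {dual_transition_op \<tau> ^^ n | n. n \<ge> 1}}"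

end

theory Submission
  imports Defs
begin

text \<open>The probability \<open>h z\<close> that the random orbit of \<open>z\<close> never enters the Fatou set of the semigroup is
  upper semicontinuous and harmonic for the chain killed on entering.  If its maximum were positive,
  every element of the semigroup would map a maximum point into the Julia set, which would put that point
  into the kernel Julia set.  Hence almost every random orbit of every point enters the
  Fatou set, and after that time the compositions are equicontinuous; Fubini gives the statement on area.
  By dominated convergence the functions \<open>M\<^sub>\<tau>\<^sup>n \<phi>\<close> are equicontinuous for each continuous \<open>\<phi>\<close>, and
  sequential compactness of the space of probability measures turns this into equicontinuity of the
  iterates of the dual operator.\<close>

section \<open>Continuity of rational maps on the sphere\<close>

text \<open>Emptiness of the kernel Julia set says exactly that every point is moved out of the
  Julia set by some element of the semigroup, and it enters only in this form. The equality case of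
  the harmonic relation is an almost-everywhere statement about maps, while the semigroup is
  generated by all maps of the support; upper semicontinuity bridges the gap, because the
  exceptional maps then form an open null set. For the dual operator the number of iterations and
  the measure vary together, so the test function moves along the sequence; equicontinuity of the
  functions \<open>M\<^sub>\<tau>\<^sup>n \<phi>\<close> makes weak convergence uniform over them.
  Convergent subsequences of measures come from Helly selection on the line. It is carried over to
  the sphere through a Borel injection into [0, 1] which need not be continuous but has a uniformly
  continuous inverse.\<close>

lemma tendsto_csphere_iff: "(f \<longlongrightarrow> x) F \<longleftrightarrow> ((\<lambda>a. stereo (f a)) \<longlongrightarrow> stereo x) F"
proof
  have b: "\<bar>stereo y \<bullet> stereo z\<bar> \<le> 1" for y z
    using Cauchy_Schwarz_ineq2[of "stereo y" "stereo z"] by simp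
  \<comment> \<open>Law of cosines: the chord is a continuous function of the arc, which settles one
    direction; the other rests on continuity of \<open>arccos\<close>.\<close>
  have c: "(norm (stereo y - stereo z))\<^sup>2 = 2 - 2 * cos (dist y z)" for y z
  proof -
    have "cos (dist y z) = stereo y \<bullet> stereo z"
      unfolding dist_csphere_def using b[of y z] by (rule cos_arccos_abs)
    moreover have "(norm (stereo y - stereo z))\<^sup>2 = 2 - 2 * (stereo y \<bullet> stereo z)"
      using dot_norm_neg[of "stereo y" "stereo z"] by simp
    ultimately show ?thesis by simp
  qed
  show "((\<lambda>a. stereo (f a)) \<longlongrightarrow> stereo x) F" if "(f \<longlongrightarrow> x) F"
  proof -
    have "((\<lambda>a. dist (f a) x) \<longlongrightarrow> 0) F" using that by (simp add: tendsto_dist_iff[symmetric])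
    then have "((\<lambda>a. sqrt (2 - 2 * cos (dist (f a) x))) \<longlongrightarrow> sqrt (2 - 2 * cos 0)) F"
      by (intro tendsto_intros isCont_tendsto_compose[OF isCont_cos])
    moreover have "norm (stereo y - stereo z) = sqrt (2 - 2 * cos (dist y z))" for y z
      by (metis c norm_ge_zero real_sqrt_unique)
    ultimately have "((\<lambda>a. norm (stereo (f a) - stereo x)) \<longlongrightarrow> 0) F" by simp
    then show ?thesis by (simp add: tendsto_norm_zero_iff Lim_null[of _ "stereo x"])
  qed
  show "(f \<longlongrightarrow> x) F" if "((\<lambda>a. stereo (f a)) \<longlongrightarrow> stereo x) F"
  proof -
    have "((\<lambda>a. dist (f a) x) \<longlongrightarrow> arccos (stereo x \<bullet> stereo x)) F"
      unfolding dist_csphere_def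
    proof (rule continuous_on_tendsto_compose[OF continuous_on_arccos'])
      show "((\<lambda>a. stereo (f a) \<bullet> stereo x) \<longlongrightarrow> stereo x \<bullet> stereo x) F"
        using that by (intro tendsto_intros)
      show "\<forall>\<^sub>F a in F. stereo (f a) \<bullet> stereo x \<in> {-1..1}"
        using b by (intro always_eventually) (auto simp: abs_le_iff minus_le_iff)
    qed (simp add: dot_square_norm)
    then show ?thesis by (simp add: tendsto_dist_iff[of f] dot_square_norm)
  qed
qed

text \<open>In homogeneous coordinates [a : b] the stereographic formula has no exceptional case at
  \<open>b = 0\<close> and is continuous away from the origin, so poles of a rational map need no
  separate argument.\<close>

lemma stereo_sphere_quot:
  assumes "a \<noteq> 0 \<or> b \<noteq> 0"
  shows "stereo (sphere_quot a b) =
    ((2 / ((cmod a)\<^sup>2 + (cmod b)\<^sup>2)) *\<^sub>R (a * cnj b), ((cmod a)\<^sup>2 - (cmod b)\<^sup>2) / ((cmod a)\<^sup>2 + (cmod b)\<^sup>2))"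
proof (cases "b = 0")
  case False
  define A B where "A = (cmod a)\<^sup>2" and "B = (cmod b)\<^sup>2"
  have B: "B > 0" "A \<ge> 0" using False by (auto simp: A_def B_def)
  have "b * cnj b = of_real B"
    by (simp add: B_def complex_norm_square[symmetric] del: of_real_power)
  then have ab: "a / b = (1 / B) *\<^sub>R (a * cnj b)"
    using False B by (simp add: scaleR_conv_of_real divide_simps) (simp add: algebra_simps)
  have n: "(cmod (a / b))\<^sup>2 = A / B" by (simp add: norm_divide power_divide A_def B_def)
  have "2 / (1 + A / B) = 2 * B / (A + B)" "(A / B - 1) / (A / B + 1) = (A - B) / (A + B)"
    using B by (simp_all add: divide_simps)
  then have "stereo (Pt (a / b)) = ((2 * B / (A + B)) *\<^sub>R (a / b), (A - B) / (A + B))"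
    by (simp only: stereo.simps n)
  also have "(2 * B / (A + B)) *\<^sub>R (a / b) = (2 / (A + B)) *\<^sub>R (a * cnj b)"
    using B unfolding ab by simp
  finally show ?thesis using False by (simp add: sphere_quot_def A_def B_def)
next
  case True
  then show ?thesis using assms by (simp add: sphere_quot_def)
qed

lemma tendsto_sphere_quot:
  assumes "(f \<longlongrightarrow> a) F" "(g \<longlongrightarrow> b) F" "a \<noteq> 0 \<or> b \<noteq> 0"
  shows "((\<lambda>x. sphere_quot (f x) (g x)) \<longlongrightarrow> sphere_quot a b) F"
  unfolding tendsto_csphere_iff
proof (rule Lim_transform_eventually)
  have nz: "(cmod a)\<^sup>2 + (cmod b)\<^sup>2 \<noteq> 0" using assms(3) by (auto simp: sum_power2_eq_zero_iff)
  show "((\<lambda>x. ((2 / ((cmod (f x))\<^sup>2 + (cmod (g x))\<^sup>2)) *\<^sub>R (f x * cnj (g x)),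
      ((cmod (f x))\<^sup>2 - (cmod (g x))\<^sup>2) / ((cmod (f x))\<^sup>2 + (cmod (g x))\<^sup>2))) \<longlongrightarrow> stereo (sphere_quot a b)) F"
    unfolding stereo_sphere_quot[OF assms(3)]
    using assms(1,2) nz by (intro tendsto_intros)
  have "((\<lambda>x. (cmod (f x))\<^sup>2 + (cmod (g x))\<^sup>2) \<longlongrightarrow> (cmod a)\<^sup>2 + (cmod b)\<^sup>2) F"
    using assms(1,2) by (intro tendsto_intros)
  then have "\<forall>\<^sub>F x in F. (cmod (f x))\<^sup>2 + (cmod (g x))\<^sup>2 \<noteq> 0"
    using nz by (rule tendsto_imp_eventually_ne)
  then show "\<forall>\<^sub>F x in F. ((2 / ((cmod (f x))\<^sup>2 + (cmod (g x))\<^sup>2)) *\<^sub>R (f x * cnj (g x)),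
      ((cmod (f x))\<^sup>2 - (cmod (g x))\<^sup>2) / ((cmod (f x))\<^sup>2 + (cmod (g x))\<^sup>2)) = stereo (sphere_quot (f x) (g x))"
    by eventually_elim (rule stereo_sphere_quot[symmetric], auto)
qed

lemma sphere_quot_cancel: "k \<noteq> 0 \<Longrightarrow> sphere_quot (k * a) (k * b) = sphere_quot a b"
  by (simp add: sphere_quot_def)

lemma continuous_Pt: "continuous_on UNIV Pt"
proof -
  have "continuous_on UNIV (\<lambda>z. sphere_quot z 1)"
    unfolding continuous_on_def by (intro ballI tendsto_sphere_quot tendsto_intros) simp
  then show ?thesis by (simp add: sphere_quot_def)
qed

text \<open>The affine chart as projection from the north pole. Its value at \<open>Infty\<close>
  comes from a division by zero and is harmless, since limits are taken at finite points
  only.\<close>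

lemma csphere_coordinate:
  "\<exists>c. (\<forall>z. c (Pt z) = z) \<and> (\<forall>z. (c \<longlongrightarrow> z) (at (Pt z)))"
proof (intro exI conjI allI)
  define c where "c y = (1 / (1 - snd (stereo y))) *\<^sub>R fst (stereo y)" for y
  have p: "1 + (cmod z)\<^sup>2 \<noteq> 0" for z by (smt (verit) zero_le_power2)
  have h: "((cmod z)\<^sup>2 - 1) / ((cmod z)\<^sup>2 + 1) = 1 - 2 / (1 + (cmod z)\<^sup>2)" for z
    using p[of z] by (simp add: divide_simps)
  show c: "c (Pt z) = z" for z
  proof -
    have "1 - snd (stereo (Pt z)) = 2 / (1 + (cmod z)\<^sup>2)" by (simp add: h)
    moreover have "fst (stereo (Pt z)) = (2 / (1 + (cmod z)\<^sup>2)) *\<^sub>R z" by simp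
    moreover have "1 / (2 / r) * (2 / r) = 1" if "r \<noteq> 0" for r :: real using that by simp
    ultimately show ?thesis using p[of z] unfolding c_def by (metis scaleR_one scaleR_scaleR)
  qed
  show "(c \<longlongrightarrow> z) (at (Pt z))" for z
  proof -
    have "(stereo \<longlongrightarrow> stereo (Pt z)) (at (Pt z))"
      using tendsto_csphere_iff[of "\<lambda>y. y"] tendsto_ident_at by blast
    moreover have "1 - snd (stereo (Pt z)) \<noteq> 0" using p[of z] by (simp add: h)
    ultimately have "(c \<longlongrightarrow> c (Pt z)) (at (Pt z))" unfolding c_def by (intro tendsto_intros)
    then show ?thesis by (simp add: c)
  qed
qed

text \<open>Projection from the south pole sends \<open>Pt z\<close> to the conjugate of
  \<open>1 / z\<close>; hence the \<open>cnj\<close> in the chart.\<close>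

lemma csphere_coordinate_Infty:
  "\<exists>c. c Infty = 0 \<and> (\<forall>z. z \<noteq> 0 \<longrightarrow> c (Pt z) = 1 / z) \<and> (c \<longlongrightarrow> 0) (at Infty)"
proof (intro exI conjI allI impI)
  define c where "c y = (1 / (1 + snd (stereo y))) *\<^sub>R cnj (fst (stereo y))" for y
  show c: "c Infty = 0" by (simp add: c_def)
  show "c (Pt z) = 1 / z" if z: "z \<noteq> 0" for z
  proof -
    define A where "A = (cmod z)\<^sup>2"
    have A: "A > 0" using z by (simp add: A_def)
    have "1 + snd (stereo (Pt z)) = 2 * A / (1 + A)" using A by (simp add: A_def[symmetric] field_simps)
    moreover have "fst (stereo (Pt z)) = (2 / (1 + A)) *\<^sub>R z" by (simp add: A_def)
    ultimately have "c (Pt z) = (1 / A) *\<^sub>R cnj z"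
      using A unfolding c_def by (simp del: stereo.simps add: field_simps)
    also have "\<dots> = 1 / z"
      using z complex_norm_square[of z] A
      by (simp add: A_def scaleR_conv_of_real field_simps)
    finally show ?thesis .
  qed
  have "(stereo \<longlongrightarrow> stereo Infty) (at Infty)"
    using tendsto_csphere_iff[of "\<lambda>y. y"] tendsto_ident_at by blast
  then have "(c \<longlongrightarrow> c Infty) (at Infty)" unfolding c_def by (intro tendsto_intros) auto
  then show "(c \<longlongrightarrow> 0) (at Infty)" by (simp add: c)
qed


lemma continuous_on_rational_fun:
  assumes "coprime p q"
  shows "continuous_on UNIV (rational_fun p q)"
proof -
  have "(rational_fun p q \<longlongrightarrow> rational_fun p q x) (at x)" for x
  proof (cases x)
    case (Pt z)
    obtain c where c: "\<And>z. c (Pt z) = z" "\<And>z. (c \<longlongrightarrow> z) (at (Pt z))" using csphere_coordinate by blast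
    have "poly p z \<noteq> 0 \<or> poly q z \<noteq> 0" using assms coprime_poly_0 by blast
    then have "((\<lambda>y. sphere_quot (poly p (c y)) (poly q (c y))) \<longlongrightarrow> rational_fun p q x) (at x)"
      unfolding Pt rational_fun.simps by (intro tendsto_sphere_quot tendsto_intros c(2))
    moreover have "\<forall>\<^sub>F y in at x. y \<noteq> Infty"
      using Pt by (intro tendsto_imp_eventually_ne[OF tendsto_ident_at]) simp
    then have "\<forall>\<^sub>F y in at x. sphere_quot (poly p (c y)) (poly q (c y)) = rational_fun p q y"
      by eventually_elim (metis c(1) csphere.exhaust rational_fun.simps(1))
    ultimately show ?thesis by (rule Lim_transform_eventually)
  next
    case Infty
    obtain c where c: "c Infty = 0" "\<And>z. z \<noteq> 0 \<Longrightarrow> c (Pt z) = 1 / z" "(c \<longlongrightarrow> 0) (at Infty)"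
      using csphere_coordinate_Infty by blast
    define d where "d = max (degree p) (degree q)"
    \<comment> \<open>\<open>R r\<close> is the reversed polynomial, w^d r(1 / w). Reversing p and q
      multiplies both by the same factor \<open>(1 / z) ^ d\<close>, which cancels in
      \<open>sphere_quot\<close>, and the value at 0 is the coefficient that defines the map at
      infinity.\<close>
    define R where "R r w = (\<Sum>i\<le>d. coeff r i * w ^ (d - i))" for r :: "complex poly" and w
    have R0: "R r 0 = coeff r d" for r
    proof -
      have "R r 0 = (\<Sum>i\<le>d. if i = d then coeff r i else 0)"
        unfolding R_def by (intro sum.cong) (auto simp: power_0_left)
      then show ?thesis by simp
    qed
    have Rp: "R r (1 / z) = (1 / z) ^ d * poly r z" if z: "z \<noteq> 0" and "degree r \<le> d" for r z
    proof -
      have "poly r z = (\<Sum>i\<le>d. coeff r i * z ^ i)"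
        using that(2) by (subst poly_altdef) (intro sum.mono_neutral_left, auto simp: coeff_eq_0)
      also have "(1 / z) ^ d * \<dots> = (\<Sum>i\<le>d. coeff r i * (1 / z) ^ (d - i))"
        unfolding sum_distrib_left
      proof (intro sum.cong refl)
        fix i assume "i \<in> {..d}"
        then have "(1 / z) ^ d = (1 / z) ^ (d - i) * (1 / z) ^ i"
          by (simp add: power_add[symmetric])
        moreover have "(1 / z) ^ i * z ^ i = 1" using z by (simp add: power_mult_distrib[symmetric])
        ultimately show "(1 / z) ^ d * (coeff r i * z ^ i) = coeff r i * (1 / z) ^ (d - i)"
          by (metis (no_types, lifting) mult.assoc mult.commute mult.right_neutral)
      qed
      finally show ?thesis by (simp add: R_def)
    qed
    have "p \<noteq> 0 \<or> q \<noteq> 0" using assms by auto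
    \<comment> \<open>Some nonzero polynomial among p and q attains the degree d, even if the other
      one vanishes.\<close>
    then have nz: "R p 0 \<noteq> 0 \<or> R q 0 \<noteq> 0"
      unfolding R0 d_def
      by (metis degree_0 le_zero_eq leading_coeff_0_iff linorder_linear max.absorb1 max.absorb2)
    have "((\<lambda>y. R r (c y)) \<longlongrightarrow> R r 0) (at Infty)" for r
      unfolding R_def by (intro tendsto_intros c(3))
    then have "((\<lambda>y. sphere_quot (R p (c y)) (R q (c y))) \<longlongrightarrow> sphere_quot (R p 0) (R q 0)) (at Infty)"
      using nz by (intro tendsto_sphere_quot) auto
    moreover have "\<forall>\<^sub>F y in at Infty. y \<noteq> Pt 0"
      by (intro tendsto_imp_eventually_ne[OF tendsto_ident_at]) simp
    then have "\<forall>\<^sub>F y in at Infty. sphere_quot (R p (c y)) (R q (c y)) = rational_fun p q y"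
    proof eventually_elim
      case (elim y)
      show ?case
      proof (cases y)
        case (Pt z)
        then have "z \<noteq> 0" using elim by auto
        then show ?thesis
          using Pt by (simp add: c(2) Rp d_def sphere_quot_cancel del: power_one_over)
      qed (simp add: c(1) R0 d_def Let_def)
    qed
    ultimately show ?thesis using Infty by (simp add: Lim_transform_eventually R0 Let_def d_def)
  qed
  then show ?thesis by (simp add: continuous_on_def)
qed

lemma continuous_on_rapply: "continuous_on UNIV (rapply g)"
  using rapply[of g] continuous_on_rational_fun by auto

section \<open>Separability and measurability\<close>

lemma compact_finite_nets:
  assumes "compact (UNIV :: 'a::metric_space set)"
  obtains X :: "nat \<Rightarrow> 'a::metric_space set"
  where "\<And>n. finite (X n)" "\<And>n x. \<exists>a\<in>X n. dist x a < 1 / real (Suc n)"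
proof -
  have "\<exists>X. finite X \<and> (UNIV :: 'a set) \<subseteq> (\<Union>a\<in>X. ball a (1 / real (Suc n)))" for n
    using assms unfolding compact_eq_totally_bounded by simp
  then obtain X :: "nat \<Rightarrow> 'a set"
    where X: "\<And>n. finite (X n)" "\<And>n. UNIV \<subseteq> (\<Union>a\<in>X n. ball a (1 / real (Suc n)))"
    by metis
  have "\<exists>a\<in>X n. dist x a < 1 / real (Suc n)" for n x
  proof -
    have "x \<in> (\<Union>a\<in>X n. ball a (1 / real (Suc n)))" using X(2) by blast
    then show ?thesis by (auto simp: dist_commute[of x])
  qed
  then show thesis using X(1) that by blast
qed

lemma dense_imp_countable_subbasis:
  fixes D :: "'a::metric_space set"
  assumes "countable D" and dense: "\<And>x e. e > 0 \<Longrightarrow> \<exists>d\<in>D. dist x d < e"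
  shows "\<exists>B :: 'a set set. countable B \<and> open = generate_topology B"
proof (intro exI conjI)
  let ?B = "(\<lambda>(d, n). ball d (1 / real (Suc n))) ` (D \<times> UNIV)"
  show "countable ?B" using assms(1) by simp
  have "topological_basis ?B"
  proof (rule topological_basisI)
    fix O' and x :: 'a assume "open O'" "x \<in> O'"
    then obtain e where e: "e > 0" "ball x e \<subseteq> O'" by (metis open_contains_ball)
    then obtain n where n: "1 / real (Suc n) < e / 2" using nat_approx_posE[of "e / 2"] by auto
    obtain d where d: "d \<in> D" "dist x d < 1 / real (Suc n)" using dense[of "1 / real (Suc n)" x] by auto
    have "ball d (1 / real (Suc n)) \<subseteq> ball x e"
    proof
      fix y assume "y \<in> ball d (1 / real (Suc n))"
      then have "dist d y < 1 / real (Suc n)" by simp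
      then show "y \<in> ball x e" using dist_triangle[of x y d] d(2) n by simp
    qed
    moreover have "x \<in> ball d (1 / real (Suc n))" using d(2) by (simp add: dist_commute)
    ultimately show "\<exists>B'\<in>?B. x \<in> B' \<and> B' \<subseteq> O'" using d(1) e(2)
      by (intro bexI[of _ "ball d (1 / real (Suc n))"]) auto
  qed auto
  then show "open = generate_topology ?B" by (rule topological_basis_imp_subbasis)
qed

text \<open>A map is recorded by a precision n, a net level m fine enough for its own modulus of
  continuity, and a rounding of its values on \<open>X m\<close> to points of \<open>Y n\<close>.
  There are countably many records, and maps sharing a record are uniformly close. Representatives
  are chosen inside \<open>F\<close>, so the dense set consists of members of
  \<open>F\<close>.\<close>

lemma uniformly_dense_countable_subset:
  fixes F :: "('a::metric_space \<Rightarrow> 'b::metric_space) set"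
  assumes "compact (UNIV :: 'a set)" "compact (UNIV :: 'b set)"
    and cont: "\<And>f. f \<in> F \<Longrightarrow> continuous_on UNIV f"
  obtains D where "countable D" "D \<subseteq> F"
    "\<And>f e. f \<in> F \<Longrightarrow> e > 0 \<Longrightarrow> \<exists>g\<in>D. \<forall>x. dist (f x) (g x) < e"
proof -
  obtain X :: "nat \<Rightarrow> 'a set"
    where X: "\<And>n. finite (X n)" "\<And>n x. \<exists>a\<in>X n. dist x a < 1 / real (Suc n)"
    using compact_finite_nets[OF assms(1)] by blast
  obtain Y :: "nat \<Rightarrow> 'b set"
    where Y: "\<And>n. finite (Y n)" "\<And>n x. \<exists>a\<in>Y n. dist x a < 1 / real (Suc n)"
    using compact_finite_nets[OF assms(2)] by blast
  define good where "good n m \<phi> f \<longleftrightarrow> f \<in> F \<and>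
      (\<forall>x y. dist x y < 1 / real (Suc m) \<longrightarrow> dist (f x) (f y) < 1 / real (Suc n)) \<and>
      (\<forall>a\<in>X m. dist (f a) (\<phi> a) < 1 / real (Suc n))" for n m \<phi> f
  define I where "I = (SIGMA n:UNIV. SIGMA m:UNIV. X m \<rightarrow>\<^sub>E Y n)"
  define D where "D = (\<lambda>(n, m, \<phi>). SOME f. good n m \<phi> f) ` {(n, m, \<phi>) \<in> I. \<exists>f. good n m \<phi> f}"
  have "countable (X m \<rightarrow>\<^sub>E Y n)" for m n
    using X(1) Y(1) by (intro countable_finite finite_PiE) auto
  then have "countable I" unfolding I_def by simp
  then have "countable D"
    unfolding D_def by (intro countable_image) (rule countable_subset[of _ I], auto)
  moreover have "D \<subseteq> F"
    unfolding D_def by clarsimp (metis (mono_tags, lifting) good_def someI)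
  moreover have "\<exists>g\<in>D. \<forall>x. dist (f x) (g x) < e" if f: "f \<in> F" and e: "e > 0" for f e
  proof -
    \<comment> \<open>Four steps of size \<open>1 / real (Suc n)\<close> lead from
      \<open>f x\<close> to \<open>g x\<close>, over \<open>f a\<close>, the rounded value and
      \<open>g a\<close>; hence e / 4.\<close>
    obtain n where n: "1 / real (Suc n) < e / 4" using nat_approx_posE[of "e / 4"] e by auto
    have "uniformly_continuous_on UNIV f" by (rule compact_uniformly_continuous[OF cont[OF f] assms(1)])
    then obtain d where d: "d > 0" "\<And>x y. dist x y < d \<Longrightarrow> dist (f x) (f y) < 1 / real (Suc n)"
      unfolding uniformly_continuous_on_def by (metis UNIV_I divide_pos_pos of_nat_0_less_iff zero_less_Suc zero_less_one)
    obtain m where m: "1 / real (Suc m) < d" using nat_approx_posE[OF d(1)] .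
    define \<phi> where "\<phi> = (\<lambda>a\<in>X m. SOME y. y \<in> Y n \<and> dist (f a) y < 1 / real (Suc n))"
    have \<phi>: "\<phi> a \<in> Y n \<and> dist (f a) (\<phi> a) < 1 / real (Suc n)" if "a \<in> X m" for a
      using that someI_ex[of "\<lambda>y. y \<in> Y n \<and> dist (f a) y < 1 / real (Suc n)"] Y(2)[of n "f a"]
      by (auto simp: \<phi>_def)
    have gf: "good n m \<phi> f" using f \<phi> d(2) m unfolding good_def by (meson less_trans)
    define g where "g = (SOME f. good n m \<phi> f)"
    have gg: "good n m \<phi> g" unfolding g_def by (rule someI[of _ f]) (rule gf)
    have "(n, m, \<phi>) \<in> I" using \<phi> by (auto simp: I_def \<phi>_def)
    then have "g \<in> D" unfolding D_def g_def using gf by force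
    moreover have "dist (f x) (g x) < e" for x
    proof -
      obtain a where a: "a \<in> X m" "dist x a < 1 / real (Suc m)" using X(2) by blast
      have "dist (f x) (f a) < 1 / real (Suc n)" "dist (f a) (\<phi> a) < 1 / real (Suc n)"
        "dist (g x) (g a) < 1 / real (Suc n)" "dist (g a) (\<phi> a) < 1 / real (Suc n)"
        using gf gg a unfolding good_def by blast+
      moreover have "dist (f x) (g x) \<le> dist (f x) (f a) + dist (f a) (\<phi> a) + dist (g a) (\<phi> a) + dist (g x) (g a)"
        using dist_triangle[of "f x" "g x" "f a"] dist_triangle2[of "f a" "g x" "\<phi> a"]
          dist_triangle[of "g x" "\<phi> a" "g a"] by (simp add: dist_commute)
      ultimately show ?thesis using n by linarith
    qed
    ultimately show ?thesis by blast
  qed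
  ultimately show thesis using that by blast
qed

text \<open>Second countability lets rectangles generate the Borel sets of products; completeness is
  what later allows a uniformly continuous inverse to be extended to a closure.\<close>

instance csphere :: polish_space
proof
  obtain X :: "nat \<Rightarrow> csphere set"
    where X: "\<And>n. finite (X n)" "\<And>n x. \<exists>a\<in>X n. dist x a < 1 / real (Suc n)"
    using compact_finite_nets[OF compact_csphere] by blast
  show "\<exists>B :: csphere set set. countable B \<and> open = generate_topology B"
  proof (rule dense_imp_countable_subbasis)
    show "countable (\<Union>n. X n)" using X(1) by (auto intro: countable_finite)
    fix x :: csphere and e :: real assume "e > 0"
    then obtain n where "1 / real (Suc n) < e" using nat_approx_posE by blast
    then show "\<exists>d\<in>\<Union>n. X n. dist x d < e" using X(2)[of n x] by (force intro: less_trans)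
  qed
  show "convergent f" if "Cauchy f" for f :: "nat \<Rightarrow> csphere"
    using compact_imp_complete[OF compact_csphere] that
    unfolding complete_def convergent_def by blast
qed

lemma dist_rapply_le: "dist (rapply f z) (rapply g z) \<le> dist f g"
proof -
  have "bdd_above (range (\<lambda>z. dist (rapply f z) (rapply g z)))"
    by (auto intro!: bdd_aboveI[of _ pi] dist_csphere_le_pi)
  then show ?thesis unfolding dist_ratmap_def by (intro cSUP_upper) auto
qed

text \<open>Serves two purposes: evaluation becomes measurable for the product of the Borel
  algebras, and a Borel measure on maps is carried by its support.\<close>

instance ratmap :: second_countable_topology
proof
  obtain D where D: "countable D" "D \<subseteq> range rapply"
    "\<And>f e. f \<in> range rapply \<Longrightarrow> e > 0 \<Longrightarrow> \<exists>g\<in>D. \<forall>x. dist (f x) (g x) < e"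
    using uniformly_dense_countable_subset[OF compact_csphere compact_csphere, of "range rapply"]
      continuous_on_rapply by blast
  show "\<exists>B :: ratmap set set. countable B \<and> open = generate_topology B"
  proof (rule dense_imp_countable_subbasis)
    show "countable (Abs_ratmap ` D)" using D(1) by simp
    fix f :: ratmap and e :: real assume e: "e > 0"
    then obtain g where g: "g \<in> D" "\<And>x. dist (rapply f x) (g x) < e / 2"
      using D(3)[of "rapply f" "e / 2"] by auto
    then obtain h where h: "g = rapply h" using D(2) by blast
    have "dist f h \<le> e / 2"
      unfolding dist_ratmap_def using g(2) h by (intro cSUP_least) (auto intro: less_imp_le)
    then show "\<exists>d\<in>Abs_ratmap ` D. dist f d < e"
    proof (intro bexI[of _ h])
      show "h \<in> Abs_ratmap ` D" using g(1) h by (metis image_eqI rapply_inverse)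
    qed (use e in simp)
  qed
qed

text \<open>The uniform distance lets the map be replaced by \<open>f\<close> at a cost independent
  of the point; what remains is continuity of the fixed map \<open>f\<close>.\<close>

lemma continuous_on_case_prod_rapply: "continuous_on UNIV (\<lambda>(g, z). rapply g z)"
proof -
  have "((\<lambda>x. rapply (fst x) (snd x)) \<longlongrightarrow> rapply f z) (at (f, z))" for f z
  proof -
    have "((\<lambda>x. rapply f (snd x)) \<longlongrightarrow> rapply f (snd (f, z))) (at (f, z))"
      by (rule continuous_on_tendsto_compose[OF continuous_on_rapply]) (intro tendsto_intros, auto)
    then have 1: "((\<lambda>x. dist (rapply f (snd x)) (rapply f z)) \<longlongrightarrow> 0) (at (f, z))"
      by (simp add: tendsto_dist_iff[symmetric])
    have "((\<lambda>x. fst x) \<longlongrightarrow> fst (f, z)) (at (f, z))" by (intro tendsto_intros)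
    then have 2: "((\<lambda>x. dist (fst x) f) \<longlongrightarrow> 0) (at (f, z))" by (simp add: tendsto_dist_iff[symmetric])
    have 3: "((\<lambda>x. dist (fst x) f + dist (rapply f (snd x)) (rapply f z)) \<longlongrightarrow> 0) (at (f, z))"
      using tendsto_add[OF 2 1] by simp
    have le: "dist (rapply (fst x) (snd x)) (rapply f z) \<le> dist (fst x) f + dist (rapply f (snd x)) (rapply f z)" for x
      using dist_triangle[of "rapply (fst x) (snd x)" "rapply f z" "rapply f (snd x)"]
        dist_rapply_le[of "fst x" "snd x" f] by linarith
    show ?thesis
      unfolding tendsto_dist_iff[of "\<lambda>x. rapply (fst x) (snd x)"]
      by (rule tendsto_sandwich[OF _ _ tendsto_const 3]) (auto intro: le always_eventually)
  qed
  then show ?thesis by (auto simp: continuous_on_def case_prod_beta')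
qed

lemma measurable_rapply [measurable]:
  assumes [measurable]: "f \<in> borel_measurable M" "h \<in> borel_measurable M"
  shows "(\<lambda>x. rapply (f x) (h x)) \<in> borel_measurable M"
proof -
  have "(\<lambda>(g, z). rapply g z) \<in> borel_measurable (borel \<Otimes>\<^sub>M borel)"
    unfolding borel_prod by (rule borel_measurable_continuous_onI[OF continuous_on_case_prod_rapply])
  from measurable_compose[OF _ this, of "\<lambda>x. (f x, h x)" M] show ?thesis by simp
qed

text \<open>The complement of the support is the union of all null open sets; by Lindelof countably
  many of them cover it, so it is null.\<close>

lemma AE_measure_support:
  fixes \<mu> :: "'a::second_countable_topology measure"
  assumes "sets \<mu> = sets borel"
  shows "AE x in \<mu>. x \<in> measure_support \<mu>"
proof -
  define \<U> where "\<U> = {U :: 'a set. open U \<and> emeasure \<mu> U = 0}"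
  obtain \<V> where \<V>: "\<V> \<subseteq> \<U>" "countable \<V>" "\<Union>\<V> = \<Union>\<U>"
    using Lindelof[of \<U>] unfolding \<U>_def by blast
  have "\<Union>\<V> \<in> null_sets \<mu>"
    using \<V>(1,2) assms unfolding \<U>_def
    by (intro null_sets_UN'[of \<V> "\<lambda>x. x", simplified] null_setsI) auto
  moreover have "- measure_support \<mu> = \<Union>\<V>"
    unfolding \<V>(3) by (auto simp: \<U>_def measure_support_def zero_less_iff_neq_zero)
  ultimately show ?thesis by (intro AE_I'[of "\<Union>\<V>"]) auto
qed

section \<open>Random orbits leave the Julia set of the semigroup\<close>

lemma space_borel_probs: "\<mu> \<in> borel_probs \<Longrightarrow> space \<mu> = UNIV"
  using sets_eq_imp_space_eq[of \<mu> borel] by (auto simp: borel_probs_def)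

lemma sequence_space_borel_probs: "\<tau> \<in> borel_probs \<Longrightarrow> sequence_space \<tau>"
  by (simp add: borel_probs_def sequence_space_def product_prob_space_def product_prob_space_axioms_def
      product_sigma_finite_def prob_space_imp_sigma_finite)

lemma prob_space_seq_measure: "\<tau> \<in> borel_probs \<Longrightarrow> prob_space (seq_measure \<tau>)"
  unfolding seq_measure_def by (intro prob_space_PiM) (simp add: borel_probs_def)

lemma space_seq_measure: "\<tau> \<in> borel_probs \<Longrightarrow> space (seq_measure \<tau>) = UNIV"
  by (auto simp: seq_measure_def space_PiM space_borel_probs PiE_def extensional_def)

lemma measurable_case_nat_seq:
  "(\<lambda>(g, \<omega>). case_nat g \<omega>) \<in> \<tau> \<Otimes>\<^sub>M seq_measure \<tau> \<rightarrow>\<^sub>M seq_measure \<tau>"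
  unfolding seq_measure_def by measurable

text \<open>The first map is independent of the remaining ones, and these have the same law as the
  whole sequence. Boundedness supplies integrability for Fubini.\<close>

lemma integral_seq_measure_step:
  fixes f :: "(nat \<Rightarrow> 'a::topological_space) \<Rightarrow> real"
  assumes \<tau>: "\<tau> \<in> borel_probs" and f: "f \<in> borel_measurable (seq_measure \<tau>)" and B: "\<And>\<gamma>. \<bar>f \<gamma>\<bar> \<le> B"
  shows "(\<integral>\<gamma>. f \<gamma> \<partial>seq_measure \<tau>) = (\<integral>g. (\<integral>\<omega>. f (case_nat g \<omega>) \<partial>seq_measure \<tau>) \<partial>\<tau>)"
proof -
  interpret sequence_space \<tau> using sequence_space_borel_probs[OF \<tau>] .
  interpret P: pair_prob_space \<tau> S
    using \<tau> prob_space_seq_measure[OF \<tau>]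
    by (simp add: pair_prob_space_def pair_sigma_finite_def borel_probs_def seq_measure_def prob_space_imp_sigma_finite)
  note m = measurable_case_nat_seq[of \<tau>, unfolded seq_measure_def]
  note f' = f[unfolded seq_measure_def]
  have mf: "(\<lambda>(g, \<omega>). f (case_nat g \<omega>)) \<in> borel_measurable (\<tau> \<Otimes>\<^sub>M S)"
    using measurable_compose[OF m f'] by (simp add: case_prod_beta')
  have "(\<integral>\<gamma>. f \<gamma> \<partial>S) = (\<integral>\<gamma>. f \<gamma> \<partial>distr (\<tau> \<Otimes>\<^sub>M S) S (\<lambda>(s, \<omega>). case_nat s \<omega>))"
    by (simp only: PiM_iter)
  also have "\<dots> = (\<integral>x. f (case x of (s, \<omega>) \<Rightarrow> case_nat s \<omega>) \<partial>(\<tau> \<Otimes>\<^sub>M S))"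
    by (rule integral_distr[OF m f'])
  also have "\<dots> = (\<integral>x. (case x of (s, \<omega>) \<Rightarrow> f (case_nat s \<omega>)) \<partial>(\<tau> \<Otimes>\<^sub>M S))"
    by (simp add: case_prod_beta')
  also have "\<dots> = (\<integral>g. (\<integral>\<omega>. f (case_nat g \<omega>) \<partial>S) \<partial>\<tau>)"
    using B mf by (intro P.integral_fst[symmetric] P.P.integrable_const_bound[of _ B]) (auto simp: case_prod_beta')
  finally show ?thesis by (simp add: seq_measure_def)
qed

lemma continuous_on_random_comp: "continuous_on UNIV (random_comp \<gamma> n)"
proof (induction n)
  case (Suc n)
  then show ?case
    by (auto intro: continuous_on_compose continuous_on_subset[OF continuous_on_rapply] simp del: o_apply)
qed (simp add: continuous_on_rapply)

lemma tendsto_random_comp: "(f \<longlongrightarrow> z) F \<Longrightarrow> ((\<lambda>a. random_comp \<gamma> n (f a)) \<longlongrightarrow> random_comp \<gamma> n z) F"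
  by (rule continuous_on_tendsto_compose[OF continuous_on_random_comp]) auto

lemma random_comp_case_nat_Suc:
  "random_comp (case_nat g \<omega>) (Suc n) z = random_comp \<omega> n (rapply g z)"
  by (induction n) auto

lemma random_comp_in_semigroup:
  assumes "\<And>i. \<gamma> i \<in> measure_support \<tau>"
  shows "random_comp \<gamma> n \<in> semigroup_of \<tau>"
  using assms unfolding semigroup_of_def
  by (induction n) (auto intro: generated_semigroup.intros)

text \<open>The two compositions have m + 1 and n + 1 factors, so together they have m + n + 2 and
  the index is \<open>Suc (m + n)\<close>.\<close>

lemma random_comp_add:
  "random_comp \<gamma> (Suc (m + n)) = random_comp (\<lambda>i. \<gamma> (Suc m + i)) n \<circ> random_comp \<gamma> m"
  by (induction n) (auto simp: fun_eq_iff)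

text \<open>Sequence and starting point vary together, because the Fubini argument for area needs
  the orbit to be jointly measurable in both.\<close>

lemma measurable_random_comp [measurable]:
  assumes \<tau>: "\<tau> \<in> borel_probs"
    and [measurable]: "f \<in> M \<rightarrow>\<^sub>M seq_measure \<tau>" "h \<in> borel_measurable M"
  shows "(\<lambda>x. random_comp (f x) n (h x)) \<in> borel_measurable M"
proof -
  have "sets \<tau> = sets borel" using \<tau> by (simp add: borel_probs_def)
  moreover have "(\<lambda>x. f x i) \<in> M \<rightarrow>\<^sub>M \<tau>" for i
    using assms(2) unfolding seq_measure_def by measurable
  ultimately have [measurable]: "(\<lambda>x. f x i) \<in> borel_measurable M" for i
    by (simp cong: measurable_cong_sets)
  show ?thesis by (induction n) simp_all
qed

lemma AE_seq_in_measure_support: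
  assumes "\<tau> \<in> borel_probs"
  shows "AE \<gamma> in seq_measure (\<tau> :: ratmap measure). \<forall>i. \<gamma> i \<in> measure_support \<tau>"
  unfolding AE_all_countable
proof
  fix i :: nat
  have "AE x in \<tau>. x \<in> measure_support \<tau>"
    using assms by (intro AE_measure_support) (simp add: borel_probs_def)
  then show "AE \<gamma> in seq_measure \<tau>. \<gamma> i \<in> measure_support \<tau>"
    unfolding seq_measure_def using assms
    by (intro AE_PiM_component) (auto simp: borel_probs_def)
qed

lemma AE_random_orbit_leaves_closed:
  assumes \<tau>: "\<tau> \<in> borel_probs" and J: "closed J"
    and leave: "\<And>z. \<exists>g\<in>semigroup_of \<tau>. g z \<notin> J"
  shows "AE \<gamma> in seq_measure \<tau>. \<exists>k. random_comp \<gamma> k z \<notin> J"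
proof -
  interpret S: prob_space "seq_measure \<tau>" by (rule prob_space_seq_measure[OF \<tau>])
  interpret T: prob_space \<tau> using \<tau> by (simp add: borel_probs_def)
  note [simp] = space_seq_measure[OF \<tau>] space_borel_probs[OF \<tau>]
  note [measurable] = measurable_random_comp[OF \<tau>]
  have sets_\<tau>: "sets \<tau> = sets borel" using \<tau> by (simp add: borel_probs_def)
  have [measurable]: "J \<in> sets borel" using J by simp
  \<comment> \<open>Membership in \<open>J\<close> is asked of the positions after at least one map,
    not of \<open>z\<close> itself; this produces the factor \<open>indicator J\<close> in
    \<open>step\<close>.\<close>
  define A where "A z = {\<gamma>. \<forall>k. random_comp \<gamma> k z \<in> J}" for z
  define h where "h z = measure (seq_measure \<tau>) (A z)" for z
  have A[measurable]: "A z \<in> sets (seq_measure \<tau>)" for z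
  proof -
    have "{\<gamma> \<in> space (seq_measure \<tau>). \<forall>k. random_comp \<gamma> k z \<in> J} \<in> sets (seq_measure \<tau>)"
      by measurable
    then show ?thesis by (simp add: A_def)
  qed
  have h01: "0 \<le> h z" "h z \<le> 1" for z by (simp_all add: h_def)
  have usc: "c \<le> h z" if zj: "zj \<longlonglongrightarrow> z" "\<And>j. c \<le> h (zj j)" for zj z c
  proof -
    \<comment> \<open>\<open>B i\<close> decreases to the event that infinitely many
      \<open>A (zj j)\<close> occur. Continuity from above keeps its probability at least
      \<open>c\<close>, and since \<open>J\<close> is closed this event is contained in
      \<open>A z\<close>.\<close>
    define B where "B i = (\<Union>j\<in>{i..}. A (zj j))" for i :: nat
    have B[measurable]: "B i \<in> sets (seq_measure \<tau>)" for i unfolding B_def by measurable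
    have "c \<le> measure (seq_measure \<tau>) (B i)" for i
    proof -
      have "c \<le> h (zj i)" by (rule zj)
      also have "\<dots> \<le> measure (seq_measure \<tau>) (B i)"
        unfolding h_def B_def[of i] by (intro S.finite_measure_mono) (use B in \<open>auto simp: B_def\<close>)
      finally show ?thesis .
    qed
    moreover have "(\<lambda>i. measure (seq_measure \<tau>) (B i)) \<longlonglongrightarrow> measure (seq_measure \<tau>) (\<Inter>i. B i)"
      using B by (intro S.finite_Lim_measure_decseq) (fastforce simp: B_def decseq_def)+
    ultimately have "c \<le> measure (seq_measure \<tau>) (\<Inter>i. B i)" by (intro LIMSEQ_le_const) auto
    also have "\<dots> \<le> h z"
      unfolding h_def
    proof (intro S.finite_measure_mono A subsetI)
      fix \<gamma> assume \<gamma>: "\<gamma> \<in> (\<Inter>i. B i)"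
      have "random_comp \<gamma> k z \<in> J" for k
      proof (rule ccontr)
        assume "random_comp \<gamma> k z \<notin> J"
        then have "\<forall>\<^sub>F j in sequentially. random_comp \<gamma> k (zj j) \<in> - J"
          using J by (intro topological_tendstoD[OF tendsto_random_comp[OF zj(1)]]) auto
        then obtain i where "\<And>j. j \<ge> i \<Longrightarrow> random_comp \<gamma> k (zj j) \<notin> J"
          by (auto simp: eventually_sequentially)
        moreover have "\<gamma> \<in> B i" using \<gamma> by blast
        ultimately show False by (auto simp: B_def A_def)
      qed
      then show "\<gamma> \<in> A z" by (simp add: A_def)
    qed
    finally show ?thesis .
  qed
  have closed_h: "closed {z. c \<le> h z}" for c
    unfolding closed_sequential_limits using usc by auto
  have [measurable]: "h \<in> borel_measurable borel"
    unfolding borel_measurable_iff_ge using closed_h by auto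
  have step: "h z = (\<integral>g. indicator J (rapply g z) * h (rapply g z) \<partial>\<tau>)" for z
  proof -
    have "h z = (\<integral>\<gamma>. indicator (A z) \<gamma> \<partial>seq_measure \<tau>)" by (simp add: h_def)
    also have "\<dots> = (\<integral>g. (\<integral>\<omega>. indicator (A z) (case_nat g \<omega>) \<partial>seq_measure \<tau>) \<partial>\<tau>)"
      by (rule integral_seq_measure_step[OF \<tau>, of _ 1]) (auto simp: indicator_def)
    also have "\<dots> = (\<integral>g. indicator J (rapply g z) * h (rapply g z) \<partial>\<tau>)"
    proof (intro Bochner_Integration.integral_cong refl)
      fix g
      have all: "(\<forall>k. P k) \<longleftrightarrow> P 0 \<and> (\<forall>k. P (Suc k))" for P :: "nat \<Rightarrow> bool"
        by (metis not0_implies_Suc)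
      have "case_nat g \<omega> \<in> A z \<longleftrightarrow> rapply g z \<in> J \<and> \<omega> \<in> A (rapply g z)" for \<omega>
        unfolding A_def mem_Collect_eq
        by (subst all) (simp only: random_comp_case_nat_Suc, simp)
      then have "(indicator (A z) (case_nat g \<omega>) :: real) = indicator J (rapply g z) * indicator (A (rapply g z)) \<omega>" for \<omega>
        by (simp add: indicator_def)
      then show "(\<integral>\<omega>. indicator (A z) (case_nat g \<omega>) \<partial>seq_measure \<tau>) = indicator J (rapply g z) * h (rapply g z)"
        by (simp add: h_def)
    qed
    finally show ?thesis .
  qed
  define m where "m = (SUP z. h z)"
  have bdd: "bdd_above (range h)" using h01 by (auto intro!: bdd_aboveI)
  have hm: "h z \<le> m" for z unfolding m_def by (rule cSUP_upper[OF _ bdd]) simp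
  obtain z0 where z0: "h z0 = m"
  proof -
    have "\<exists>z. m - 1 / real (Suc j) < h z" for j
      using less_cSUP_iff[OF _ bdd, of "m - 1 / real (Suc j)"] by (simp add: m_def)
    then obtain zj where zj: "\<And>j. m - 1 / real (Suc j) < h (zj j)" by metis
    obtain z r where r: "strict_mono (r :: nat \<Rightarrow> nat)" "(zj \<circ> r) \<longlonglongrightarrow> z"
      using compact_csphere unfolding compact_eq_seq_compact_metric seq_compact_def by (metis UNIV_I)
    have "m \<le> h z + e" if e: "e > 0" for e
    proof -
      obtain i where i: "1 / real (Suc i) < e" using nat_approx_posE[OF e] .
      \<comment> \<open>Dropping i terms brings every deviation
        \<open>1 / real (Suc (r (j + i)))\<close> below e, so that the lower bound required by
        \<open>usc\<close> holds for all terms.\<close>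
      have "m - e \<le> h z"
      proof (rule usc)
        show "(\<lambda>j. (zj \<circ> r) (j + i)) \<longlonglongrightarrow> z" using r(2) by (rule LIMSEQ_ignore_initial_segment)
        fix j
        have "i \<le> r (j + i)" using seq_suble[OF r(1), of "j + i"] by simp
        then have "1 / real (Suc (r (j + i))) \<le> 1 / real (Suc i)" by (intro divide_left_mono) auto
        then show "m - e \<le> h ((zj \<circ> r) (j + i))" using zj[of "r (j + i)"] i by simp
      qed
      then show ?thesis by simp
    qed
    then have "m \<le> h z" by (rule field_le_epsilon)
    then show thesis using hm[of z] that by simp
  qed
  have "m = 0"
  proof (rule ccontr)
    assume "m \<noteq> 0"
    then have m: "m > 0" using h01(1)[of z0] z0 by simp
    have gen: "rapply g z \<in> J \<and> h (rapply g z) = m" if z: "h z = m" and g: "g \<in> measure_support \<tau>" for g z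
    proof -
      let ?f = "\<lambda>g. indicator J (rapply g z) * h (rapply g z)"
      have [measurable]: "(\<lambda>g. rapply g z) \<in> borel_measurable \<tau>"
        using measurable_rapply[of "\<lambda>g. g" borel "\<lambda>_. z"] sets_\<tau> by (simp cong: measurable_cong_sets)
      have f01: "0 \<le> ?f g" "?f g \<le> m" for g
        using h01 hm[of "rapply g z"] m by (auto simp: indicator_def)
      have int: "integrable \<tau> ?f"
        using f01 by (intro T.integrable_const_bound[of _ m]) auto
      \<comment> \<open>At a maximum point \<open>step\<close> says that \<open>?f\<close>, which is
        bounded by m, has mean m. So it equals m almost surely, and as m > 0 the image lies in
        \<open>J\<close> and is again a maximum point.\<close>
      have "(\<integral>g. m - ?f g \<partial>\<tau>) = 0"
        using int step[of z] z T.prob_space by simp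
      then have "AE g in \<tau>. m - ?f g = 0"
        using int f01(2) by (subst (asm) integral_nonneg_eq_0_iff_AE) auto
      then have ae: "AE g in \<tau>. rapply g z \<in> J \<inter> {z. m \<le> h z}"
      proof eventually_elim
        case (elim g)
        then show ?case using m by (cases "rapply g z \<in> J") auto
      qed
      \<comment> \<open>\<open>U\<close> is open because \<open>J\<close> and the superlevel set of
        \<open>h\<close> are closed. An open null set misses the support, which replaces "almost
        every map" by "every map of the support".\<close>
      define U where "U = {g. rapply g z \<notin> J \<inter> {z. m \<le> h z}}"
      have "continuous_on UNIV (\<lambda>g. rapply g z)"
        using continuous_on_compose2[OF continuous_on_case_prod_rapply
            continuous_on_Pair[OF continuous_on_id continuous_on_const[of _ z]]] by simp
      moreover have "open (- (J \<inter> {z. m \<le> h z}))" by (intro open_Compl closed_Int J closed_h)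
      ultimately have "open ((\<lambda>g. rapply g z) -` (- (J \<inter> {z. m \<le> h z})))" by (rule open_vimage[rotated])
      then have "open U" by (simp add: U_def vimage_def)
      moreover have "emeasure \<tau> U = 0"
      proof -
        have "U \<in> sets \<tau>" using \<open>open U\<close> sets_\<tau> by simp
        moreover have "AE g in \<tau>. g \<notin> U" using ae by (simp add: U_def)
        ultimately show ?thesis using AE_iff_null_sets[of U \<tau>] by auto
      qed
      ultimately have "g \<notin> U" using g by (auto simp: measure_support_def)
      then show ?thesis using hm[of "rapply g z"] by (auto simp: U_def)
    qed
    \<comment> \<open>Maximality of the image is part of the induction statement, since the outer
      factor of a composition must again start at a maximum point.\<close>
    have "\<forall>z. h z = m \<longrightarrow> g z \<in> J \<and> h (g z) = m" if "g \<in> semigroup_of \<tau>" for g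
      using that unfolding semigroup_of_def
      by (induction rule: generated_semigroup.induct) (use gen in auto)
    then show False using leave[of z0] z0 by blast
  qed
  then have "h z = 0" using hm[of z] h01(1)[of z] by simp
  then have "emeasure (seq_measure \<tau>) (A z) = 0" by (simp add: h_def S.emeasure_eq_measure)
  then show ?thesis
    using A[of z] by (intro AE_I'[of "A z"]) (auto simp: A_def null_sets_def)
qed

section \<open>Random Julia sets and their area\<close>

lemma open_fatou_set: "open (fatou_set F)"
  unfolding fatou_set_def by (subst open_subopen) blast

lemma fatou_set_equicontinuous:
  assumes "z \<in> fatou_set F" "e > 0"
  shows "\<exists>d>0. \<forall>f\<in>F. \<forall>y. dist z y < d \<longrightarrow> dist (f z) (f y) < e"
proof -
  obtain U where U: "open U" "z \<in> U" "equicontinuous_on dist dist U F"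
    using assms(1) unfolding fatou_set_def by blast
  obtain r where r: "r > 0" "ball z r \<subseteq> U" using U(1,2) by (metis open_contains_ball)
  obtain d where d: "d > 0" "\<forall>f\<in>F. \<forall>y\<in>U. dist z y < d \<longrightarrow> dist (f z) (f y) < e"
    using U(2,3) assms(2) unfolding equicontinuous_on_def by blast
  show ?thesis
    using r d by (intro exI[of _ "min d r"]) (auto simp: subset_eq)
qed

text \<open>Up to time k there are finitely many continuous maps, handled one by one. Every later
  composition is an element of the semigroup applied to the position at time k, near which the
  semigroup is equicontinuous.\<close>

lemma random_comp_hits_fatou_set:
  assumes supp: "\<And>i. \<gamma> i \<in> measure_support \<tau>"
    and hit: "random_comp \<gamma> k z \<in> fatou_set (semigroup_of \<tau>)"
  shows "z \<in> fatou_set (range (random_comp \<gamma>))"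
proof -
  obtain U where U: "open U" "random_comp \<gamma> k z \<in> U" "equicontinuous_on dist dist U (semigroup_of \<tau>)"
    using hit unfolding fatou_set_def by blast
  define V where "V = random_comp \<gamma> k -` U"
  have "open V" unfolding V_def using U(1) continuous_on_random_comp by (rule open_vimage)
  have near: "\<forall>\<^sub>F y in nhds x. dist (random_comp \<gamma> n x) (random_comp \<gamma> n y) < d" if "d > 0" for x n d
    using tendstoD[OF tendsto_random_comp[OF tendsto_ident_at[of x UNIV]] that] that
    by (simp add: eventually_nhds_conv_at dist_commute)
  have "equicontinuous_on dist dist V (range (random_comp \<gamma>))"
    unfolding equicontinuous_on_def
  proof (intro ballI allI impI)
    fix x and e :: real assume x: "x \<in> V" and e: "e > 0"
    then obtain d where d: "d > 0"
      "\<And>f y. f \<in> semigroup_of \<tau> \<Longrightarrow> y \<in> U \<Longrightarrow> dist (random_comp \<gamma> k x) y < d \<Longrightarrow> dist (f (random_comp \<gamma> k x)) (f y) < e"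
      using U(3) unfolding equicontinuous_on_def V_def by (metis vimageE)
    have "\<forall>\<^sub>F y in nhds x. (\<forall>n\<in>{..k}. dist (random_comp \<gamma> n x) (random_comp \<gamma> n y) < e) \<and>
        dist (random_comp \<gamma> k x) (random_comp \<gamma> k y) < d"
      using e d(1) by (intro eventually_conj eventually_ball_finite ballI near) auto
    then obtain r where r: "r > 0" "\<And>y. dist y x < r \<Longrightarrow>
        (\<forall>n\<in>{..k}. dist (random_comp \<gamma> n x) (random_comp \<gamma> n y) < e) \<and> dist (random_comp \<gamma> k x) (random_comp \<gamma> k y) < d"
      unfolding eventually_nhds_metric by blast
    have "dist (random_comp \<gamma> n x) (random_comp \<gamma> n y) < e" if y: "y \<in> V" "dist x y < r" for n y
    proof (cases "n \<le> k")
      case True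
      then show ?thesis using r(2)[of y] y(2) by (simp add: dist_commute)
    next
      case False
      then obtain j where j: "n = Suc (k + j)" by (metis less_iff_Suc_add not_le)
      have "random_comp (\<lambda>i. \<gamma> (Suc k + i)) j \<in> semigroup_of \<tau>"
        using supp by (rule random_comp_in_semigroup)
      then show ?thesis
        unfolding j random_comp_add o_apply using y r(2)[of y]
        by (intro d(2)) (auto simp: V_def dist_commute)
    qed
    then show "\<exists>\<delta>>0. \<forall>f\<in>range (random_comp \<gamma>). \<forall>y\<in>V. dist x y < \<delta> \<longrightarrow> dist (f x) (f y) < e"
      using r(1) by blast
  qed
  then show ?thesis using \<open>open V\<close> U(2) unfolding fatou_set_def V_def by blast
qed

lemma AE_leaves_semigroup_julia_set:
  assumes \<tau>: "\<tau> \<in> borel_probs" and ker: "kernel_julia_set (semigroup_of \<tau>) = {}"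
  shows "AE \<gamma> in seq_measure \<tau>. \<exists>k. random_comp \<gamma> k z \<notin> julia_set (semigroup_of \<tau>)"
proof (rule AE_random_orbit_leaves_closed[OF \<tau>])
  show "closed (julia_set (semigroup_of \<tau>))"
    unfolding julia_set_def using open_fatou_set by (simp add: closed_Compl)
  show "\<exists>g\<in>semigroup_of \<tau>. g z \<notin> julia_set (semigroup_of \<tau>)" for z
    using ker unfolding kernel_julia_set_def by blast
qed

lemma AE_in_random_fatou_set:
  assumes \<tau>: "\<tau> \<in> borel_probs" and ker: "kernel_julia_set (semigroup_of \<tau>) = {}"
  shows "AE \<gamma> in seq_measure \<tau>. z \<in> fatou_set (range (random_comp \<gamma>))"
  using AE_leaves_semigroup_julia_set[OF assms, of z] AE_seq_in_measure_support[OF \<tau>]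
  by eventually_elim (auto simp: julia_set_def intro: random_comp_hits_fatou_set)

text \<open>Fubini is applied to the event that the orbit never leaves \<open>J\<close>, which is
  jointly measurable in \<gamma> and z, rather than to membership in the random Julia set, for which
  this is not evident. For a fixed \<gamma> with entries in the support, the random Julia set is
  closed and contained in the null set of points whose orbit never leaves \<open>J\<close>.\<close>

lemma AE_random_julia_set_null:
  assumes \<tau>: "\<tau> \<in> borel_probs" and ker: "kernel_julia_set (semigroup_of \<tau>) = {}"
  shows "AE \<gamma> in seq_measure \<tau>. random_julia_set \<gamma> \<in> null_sets sphere_lebesgue"
proof -
  note [measurable] = measurable_random_comp[OF \<tau>]
  have [measurable]: "Pt \<in> borel_measurable borel"
    by (rule borel_measurable_continuous_onI[OF continuous_Pt])
  define J where "J = julia_set (semigroup_of \<tau>)"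
  have J[measurable]: "J \<in> sets borel"
    using open_fatou_set unfolding J_def julia_set_def by auto
  interpret S: prob_space "seq_measure \<tau>" by (rule prob_space_seq_measure[OF \<tau>])
  interpret P: pair_sigma_finite "seq_measure \<tau>" "lborel :: complex measure"
    by (simp add: pair_sigma_finite_def S.sigma_finite_measure lborel.sigma_finite_measure_axioms)
  have "AE z in (lborel :: complex measure). AE \<gamma> in seq_measure \<tau>. \<exists>k. random_comp \<gamma> k (Pt z) \<notin> J"
    unfolding J_def using AE_leaves_semigroup_julia_set[OF assms] by simp
  then have "AE \<gamma> in seq_measure \<tau>. AE z in (lborel :: complex measure). \<exists>k. random_comp \<gamma> k (Pt z) \<notin> J"
    by (subst P.AE_commute) measurable
  then show ?thesis
    using AE_seq_in_measure_support[OF \<tau>]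
  proof eventually_elim
    case (elim \<gamma>)
    define K where "K = random_julia_set \<gamma>"
    have K: "K \<in> sets borel"
      using open_fatou_set unfolding K_def random_julia_set_def julia_set_def by auto
    have "AE z in (lborel :: complex measure). Pt z \<notin> K"
      using elim(1) unfolding K_def random_julia_set_def
      by eventually_elim (use elim(2) in \<open>auto simp: julia_set_def J_def intro: random_comp_hits_fatou_set\<close>)
    then have "AE z in density lborel (\<lambda>z. ennreal (4 / (1 + (cmod z)\<^sup>2)\<^sup>2)). Pt z \<notin> K"
      by (subst AE_density) auto
    then have "AE x in sphere_lebesgue. x \<notin> K"
      unfolding sphere_lebesgue_def using K by (subst AE_distr_iff) auto
    moreover have "K \<in> sets sphere_lebesgue" using K by (simp add: sphere_lebesgue_def)
    ultimately show ?case by (simp add: AE_iff_null_sets K_def[symmetric])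
  qed
qed

section \<open>The transition operator\<close>

lemma bounded_range_continuous_csphere:
  fixes \<phi> :: "csphere \<Rightarrow> 'b::metric_space"
  shows "continuous_on UNIV \<phi> \<Longrightarrow> bounded (range \<phi>)"
  using compact_continuous_image[OF _ compact_csphere] compact_imp_bounded by blast

text \<open>The measure sought is the law of \<open>rapply g z\<close> for independent
  \<open>g\<close> and \<open>z\<close> with laws \<tau> and \<mu>; uniqueness holds because
  integrals of real test functions determine a Borel probability measure.\<close>

lemma dual_transition_op_properties:
  assumes \<tau>: "\<tau> \<in> borel_probs" and \<mu>: "\<mu> \<in> borel_probs"
  shows dual_transition_op_in_borel_probs: "dual_transition_op \<tau> \<mu> \<in> borel_probs"
    and integral_dual_transition_op: "\<And>\<phi> :: csphere \<Rightarrow> real. continuous_on UNIV \<phi> \<Longrightarrow>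
      (\<integral>z. \<phi> z \<partial>dual_transition_op \<tau> \<mu>) = (\<integral>z. (\<integral>g. \<phi> (rapply g z) \<partial>\<tau>) \<partial>\<mu>)"
proof -
  interpret T: prob_space \<tau> using \<tau> by (simp add: borel_probs_def)
  interpret M: prob_space \<mu> using \<mu> by (simp add: borel_probs_def)
  interpret P: pair_prob_space \<tau> \<mu> ..
  have sets: "sets \<tau> = sets borel" "sets \<mu> = sets borel" using \<tau> \<mu> by (simp_all add: borel_probs_def)
  have ev: "(\<lambda>(g, z). rapply g z) \<in> borel_measurable (\<tau> \<Otimes>\<^sub>M \<mu>)"
    using measurable_rapply[of fst "borel \<Otimes>\<^sub>M borel" snd]
    by (simp add: case_prod_beta' sets cong: measurable_cong_sets sets_pair_measure_cong)
  define \<nu> where "\<nu> = distr (\<tau> \<Otimes>\<^sub>M \<mu>) borel (\<lambda>(g, z). rapply g z)"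
  have \<nu>: "\<nu> \<in> borel_probs"
    using P.P.prob_space_distr[OF ev] by (simp add: borel_probs_def \<nu>_def)
  \<comment> \<open>The value type is left general: the dual operator is defined by complex test
    functions, while the conclusion concerns real ones.\<close>
  have int: "(\<integral>z. \<phi> z \<partial>\<nu>) = (\<integral>z. (\<integral>g. \<phi> (rapply g z) \<partial>\<tau>) \<partial>\<mu>)"
    if \<phi>: "continuous_on UNIV \<phi>" for \<phi> :: "csphere \<Rightarrow> 'b::{banach, second_countable_topology}"
  proof -
    have m: "\<phi> \<in> borel_measurable borel" using \<phi> by (rule borel_measurable_continuous_onI)
    obtain B where B: "\<And>x. norm (\<phi> x) \<le> B"
      using bounded_range_continuous_csphere[OF \<phi>] unfolding bounded_iff by auto
    have mc: "(\<lambda>(g, z). \<phi> (rapply g z)) \<in> borel_measurable (\<tau> \<Otimes>\<^sub>M \<mu>)"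
      using measurable_compose[OF ev m] by (simp add: case_prod_beta')
    have "(\<integral>z. \<phi> z \<partial>\<nu>) = (\<integral>x. \<phi> (case x of (g, z) \<Rightarrow> rapply g z) \<partial>(\<tau> \<Otimes>\<^sub>M \<mu>))"
      unfolding \<nu>_def by (rule integral_distr[OF ev m])
    also have "\<dots> = (\<integral>(g, z). \<phi> (rapply g z) \<partial>(\<tau> \<Otimes>\<^sub>M \<mu>))" by (simp add: case_prod_beta')
    also have "\<dots> = (\<integral>z. (\<integral>g. \<phi> (rapply g z) \<partial>\<tau>) \<partial>\<mu>)"
      using B mc
      by (intro P.integral_snd[symmetric] P.P.integrable_const_bound[of _ B]) (auto simp: case_prod_beta')
    finally show ?thesis .
  qed
  have "dual_transition_op \<tau> \<mu> = \<nu>"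
    unfolding dual_transition_op_def transition_op_def
  proof (rule the_equality)
    show "\<nu> \<in> borel_probs \<and> (\<forall>\<phi> :: csphere \<Rightarrow> complex. continuous_on UNIV \<phi> \<longrightarrow>
      (\<integral>z. \<phi> z \<partial>\<nu>) = (\<integral>z. (\<integral>g. \<phi> (rapply g z) \<partial>\<tau>) \<partial>\<mu>))"
      using \<nu> int by blast
    fix \<kappa> assume \<kappa>: "\<kappa> \<in> borel_probs \<and> (\<forall>\<phi> :: csphere \<Rightarrow> complex. continuous_on UNIV \<phi> \<longrightarrow>
      (\<integral>z. \<phi> z \<partial>\<kappa>) = (\<integral>z. (\<integral>g. \<phi> (rapply g z) \<partial>\<tau>) \<partial>\<mu>))"
    show "\<kappa> = \<nu>"
    proof (rule borel_probs_eqI)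
      fix \<phi> :: "csphere \<Rightarrow> real" assume \<phi>: "continuous_on UNIV \<phi>"
      then have "continuous_on UNIV (\<lambda>z. complex_of_real (\<phi> z))" by (intro continuous_intros)
      then have "(\<integral>z. complex_of_real (\<phi> z) \<partial>\<kappa>) = (\<integral>z. complex_of_real (\<phi> z) \<partial>\<nu>)"
        using \<kappa> int by metis
      then show "(\<integral>z. \<phi> z \<partial>\<kappa>) = (\<integral>z. \<phi> z \<partial>\<nu>)" by simp
    qed (use \<kappa> \<nu> in auto)
  qed
  then show "dual_transition_op \<tau> \<mu> \<in> borel_probs"
    "\<And>\<phi> :: csphere \<Rightarrow> real. continuous_on UNIV \<phi> \<Longrightarrow>
      (\<integral>z. \<phi> z \<partial>dual_transition_op \<tau> \<mu>) = (\<integral>z. (\<integral>g. \<phi> (rapply g z) \<partial>\<tau>) \<partial>\<mu>)"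
    using \<nu> int by auto
qed

section \<open>Iterates as means along random orbits\<close>

lemma funpow_dual_transition_op_in_borel_probs:
  assumes "\<tau> \<in> borel_probs" "\<mu> \<in> borel_probs"
  shows "(dual_transition_op \<tau> ^^ n) \<mu> \<in> borel_probs"
  using assms by (induction n) (auto intro: dual_transition_op_in_borel_probs)

text \<open>In the paper's notation, \<open>expected_value \<tau> \<phi> n\<close> is \<open>M\<^sub>\<tau>\<^sup>n\<^sup>+\<^sup>1 \<phi>\<close>, because \<open>random_comp \<gamma> n\<close> has
  \<open>n + 1\<close> factors.\<close>

definition expected_value :: "ratmap measure \<Rightarrow> (csphere \<Rightarrow> real) \<Rightarrow> nat \<Rightarrow> csphere \<Rightarrow> real" where
  "expected_value \<tau> \<phi> n z = (\<integral>\<gamma>. \<phi> (random_comp \<gamma> n z) \<partial>seq_measure \<tau>)"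

lemma abs_expected_value_le:
  assumes \<tau>: "\<tau> \<in> borel_probs" and B: "\<And>z. \<bar>\<phi> z\<bar> \<le> B"
  shows "\<bar>expected_value \<tau> \<phi> n z\<bar> \<le> B"
proof -
  interpret S: prob_space "seq_measure \<tau>" by (rule prob_space_seq_measure[OF \<tau>])
  show ?thesis
  proof (cases "integrable (seq_measure \<tau>) (\<lambda>\<gamma>. \<phi> (random_comp \<gamma> n z))")
    case True
    have "\<bar>expected_value \<tau> \<phi> n z\<bar> \<le> (\<integral>\<gamma>. \<bar>\<phi> (random_comp \<gamma> n z)\<bar> \<partial>seq_measure \<tau>)"
      unfolding expected_value_def by (rule integral_abs_bound)
    also have "\<dots> \<le> (\<integral>\<gamma>. B \<partial>seq_measure \<tau>)" using True B by (intro integral_mono) auto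
    finally show ?thesis by (simp add: S.prob_space)
  next
    \<comment> \<open>A non-integrable function has integral 0 by convention, and 0 is at most
      \<open>\<bar>\<phi> z\<bar>\<close>, hence at most \<open>B\<close>.\<close>
    case False
    then show ?thesis
      using B[of z] by (simp add: expected_value_def not_integrable_integral_eq)
  qed
qed

text \<open>A failure yields indices \<open>n j\<close> and points \<open>y j\<close> tending to
  \<open>z\<close>. For almost every \<gamma> equicontinuity at \<open>z\<close> holds for all
  indices at once, so the differences tend to 0 however \<open>n j\<close> behaves, and
  \<open>2 * B\<close> dominates them.\<close>

lemma expected_value_equicontinuous:
  assumes \<tau>: "\<tau> \<in> borel_probs" and ker: "kernel_julia_set (semigroup_of \<tau>) = {}"
    and \<phi>: "continuous_on UNIV \<phi>" and e: "e > 0"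
  shows "\<exists>d>0. \<forall>n y. dist z y < d \<longrightarrow> \<bar>expected_value \<tau> \<phi> n z - expected_value \<tau> \<phi> n y\<bar> < e"
proof (rule ccontr)
  interpret S: prob_space "seq_measure \<tau>" by (rule prob_space_seq_measure[OF \<tau>])
  note [measurable] = measurable_random_comp[OF \<tau>]
  have [measurable]: "\<phi> \<in> borel_measurable borel" using \<phi> by (rule borel_measurable_continuous_onI)
  obtain B where B: "\<And>x. \<bar>\<phi> x\<bar> \<le> B"
    using bounded_range_continuous_csphere[OF \<phi>] unfolding bounded_iff by auto
  have int: "integrable (seq_measure \<tau>) (\<lambda>\<gamma>. \<phi> (random_comp \<gamma> n x))" for n x
    using B by (intro S.integrable_const_bound[of _ B]) auto
  assume "\<not> ?thesis"
  then have "\<exists>n y. dist z y < 1 / real (Suc j) \<and> \<not> \<bar>expected_value \<tau> \<phi> n z - expected_value \<tau> \<phi> n y\<bar> < e" for j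
    by (metis of_nat_0_less_iff zero_less_Suc zero_less_divide_1_iff)
  then obtain n y where ny: "\<And>j. dist z (y j) < 1 / real (Suc j)"
    "\<And>j. \<not> \<bar>expected_value \<tau> \<phi> (n j) z - expected_value \<tau> \<phi> (n j) (y j)\<bar> < e"
    by metis
  have "uniformly_continuous_on UNIV \<phi>" by (rule compact_uniformly_continuous[OF \<phi> compact_csphere])
  then have uc: "\<exists>r>0. \<forall>x y. dist x y < r \<longrightarrow> dist (\<phi> x) (\<phi> y) < c" if "c > 0" for c
    using that unfolding uniformly_continuous_on_def by (metis UNIV_I dist_commute)
  have "AE \<gamma> in seq_measure \<tau>. (\<lambda>j. \<phi> (random_comp \<gamma> (n j) z) - \<phi> (random_comp \<gamma> (n j) (y j))) \<longlonglongrightarrow> 0"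
    using AE_in_random_fatou_set[OF \<tau> ker, of z]
  proof eventually_elim
    case (elim \<gamma>)
    show ?case
    proof (rule LIMSEQ_I)
      fix c :: real assume "c > 0"
      then obtain r where r: "r > 0" "\<And>x y. dist x y < r \<Longrightarrow> dist (\<phi> x) (\<phi> y) < c" using uc by metis
      obtain d where d: "d > 0" "\<And>n y. dist z y < d \<Longrightarrow> dist (random_comp \<gamma> n z) (random_comp \<gamma> n y) < r"
        using fatou_set_equicontinuous[OF elim r(1)] by auto
      obtain j0 where j0: "1 / real (Suc j0) < d" using nat_approx_posE[OF d(1)] .
      have "norm (\<phi> (random_comp \<gamma> (n j) z) - \<phi> (random_comp \<gamma> (n j) (y j)) - 0) < c" if "j \<ge> j0" for j
      proof -
        have "1 / real (Suc j) \<le> 1 / real (Suc j0)" using that by (intro divide_left_mono) auto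
        then have "dist z (y j) < d" using ny(1)[of j] j0 by linarith
        then show ?thesis using r(2)[OF d(2)] by (simp add: dist_real_def)
      qed
      then show "\<exists>j0. \<forall>j\<ge>j0. norm (\<phi> (random_comp \<gamma> (n j) z) - \<phi> (random_comp \<gamma> (n j) (y j)) - 0) < c"
        by blast
    qed
  qed
  moreover have "\<bar>\<phi> a - \<phi> b\<bar> \<le> 2 * B" for a b using B[of a] B[of b] by linarith
  ultimately have "(\<lambda>j. \<integral>\<gamma>. \<phi> (random_comp \<gamma> (n j) z) - \<phi> (random_comp \<gamma> (n j) (y j)) \<partial>seq_measure \<tau>)
      \<longlonglongrightarrow> (\<integral>\<gamma>. 0 \<partial>seq_measure \<tau>)"
    by (intro integral_dominated_convergence[where w = "\<lambda>_. 2 * B"]) auto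
  then have "(\<lambda>j. expected_value \<tau> \<phi> (n j) z - expected_value \<tau> \<phi> (n j) (y j)) \<longlonglongrightarrow> 0"
    using int by (simp add: expected_value_def)
  then have "\<forall>\<^sub>F j in sequentially. \<bar>expected_value \<tau> \<phi> (n j) z - expected_value \<tau> \<phi> (n j) (y j)\<bar> < e"
    using e by (auto dest: tendstoD simp: dist_real_def)
  then show False using ny(2) by (auto simp: eventually_sequentially)
qed

text \<open>Makes these means admissible test functions for the dual operator, as the induction on
  the number of iterations requires.\<close>

lemma continuous_on_expected_value:
  assumes \<tau>: "\<tau> \<in> borel_probs" and \<phi>: "continuous_on UNIV \<phi>"
  shows "continuous_on UNIV (expected_value \<tau> \<phi> n)"
  unfolding continuous_on_sequentially
proof (intro allI ballI impI, elim conjE)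
  interpret S: prob_space "seq_measure \<tau>" by (rule prob_space_seq_measure[OF \<tau>])
  note [measurable] = measurable_random_comp[OF \<tau>]
  have [measurable]: "\<phi> \<in> borel_measurable borel" using \<phi> by (rule borel_measurable_continuous_onI)
  obtain B where B: "\<And>x. \<bar>\<phi> x\<bar> \<le> B"
    using bounded_range_continuous_csphere[OF \<phi>] unfolding bounded_iff by auto
  fix y and z :: csphere assume y: "y \<longlonglongrightarrow> z"
  have "(\<lambda>j. \<phi> (random_comp \<gamma> n (y j))) \<longlonglongrightarrow> \<phi> (random_comp \<gamma> n z)" for \<gamma>
    by (rule continuous_on_tendsto_compose[OF \<phi> tendsto_random_comp[OF y]]) auto
  then show "(expected_value \<tau> \<phi> n \<circ> y) \<longlonglongrightarrow> expected_value \<tau> \<phi> n z"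
    unfolding expected_value_def o_def using B
    by (intro integral_dominated_convergence[where w = "\<lambda>_. B"]) auto
qed

lemma integral_funpow_dual_transition_op:
  assumes \<tau>: "\<tau> \<in> borel_probs"
    and \<mu>: "\<mu> \<in> borel_probs" and \<phi>: "continuous_on UNIV \<phi>"
  shows "(\<integral>z. \<phi> z \<partial>(dual_transition_op \<tau> ^^ Suc n) \<mu>) = (\<integral>z. expected_value \<tau> \<phi> n z \<partial>\<mu>)"
  using \<mu>
proof (induction n arbitrary: \<mu>)
  note [measurable] = measurable_random_comp[OF \<tau>]
  have sets_\<tau>: "sets \<tau> = sets borel" using \<tau> by (simp add: borel_probs_def)
  have [measurable]: "\<phi> \<in> borel_measurable borel" using \<phi> by (rule borel_measurable_continuous_onI)
  obtain B where B: "\<And>x. \<bar>\<phi> x\<bar> \<le> B"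
    using bounded_range_continuous_csphere[OF \<phi>] unfolding bounded_iff by auto
  have step: "(\<integral>\<gamma>. \<phi> (random_comp \<gamma> n z) \<partial>seq_measure \<tau>) =
      (\<integral>g. (\<integral>\<omega>. \<phi> (random_comp (case_nat g \<omega>) n z) \<partial>seq_measure \<tau>) \<partial>\<tau>)" for n z
    by (rule integral_seq_measure_step[OF \<tau>, of _ B]) (use B in auto)
  {
    case 0
    interpret S: prob_space "seq_measure \<tau>" by (rule prob_space_seq_measure[OF \<tau>])
    have "expected_value \<tau> \<phi> 0 z = (\<integral>g. \<phi> (rapply g z) \<partial>\<tau>)" for z
      unfolding expected_value_def step by (simp add: S.prob_space)
    then show ?case using 0 by (simp add: integral_dual_transition_op[OF \<tau> _ \<phi>])
  next
    case (Suc n)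
    note cont = continuous_on_expected_value[OF \<tau> \<phi>, of n]
    have *: "expected_value \<tau> \<phi> (Suc n) z = (\<integral>g. expected_value \<tau> \<phi> n (rapply g z) \<partial>\<tau>)" for z
      unfolding expected_value_def step[of "Suc n"] by (simp only: random_comp_case_nat_Suc)
    \<comment> \<open>The innermost application is split off because it corresponds to the first
      random map; this is why the induction ranges over all \<mu>.\<close>
    have "(dual_transition_op \<tau> ^^ Suc (Suc n)) \<mu> = (dual_transition_op \<tau> ^^ Suc n) (dual_transition_op \<tau> \<mu>)"
      by (simp only: funpow_Suc_right o_apply)
    then show ?case
      using Suc dual_transition_op_in_borel_probs[OF \<tau>]
      by (simp only: integral_dual_transition_op[OF \<tau> _ cont] *)
  }
qed

section \<open>Sequential compactness of the space of probability measures\<close>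

text \<open>The point of the middle-thirds Cantor set whose digits equal 2 exactly at the positions
  in \<open>A\<close>, counted from 0. Omitting the digit 1 leaves gaps, so close codes share their
  initial digits; this fails for binary expansions.\<close>

definition ternary_code :: "nat set \<Rightarrow> real" where
  "ternary_code A = (\<Sum>k. indicator A k * (2 / 3 ^ Suc k))"

lemma sums_ternary_tail: "(\<lambda>i. 2 / 3 ^ Suc (i + k) :: real) sums (1 / 3 ^ k)"
proof -
  have "(\<lambda>i. (2 / 3 ^ Suc k) * (1 / 3) ^ i :: real) sums ((2 / 3 ^ Suc k) * (1 / (1 - 1 / 3)))"
    by (intro sums_mult geometric_sums) simp
  moreover have "(2 / 3 ^ Suc k) * (1 / 3) ^ i = (2 / 3 ^ Suc (i + k) :: real)" for i
    by (simp add: power_add power_divide)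
  ultimately show ?thesis by simp
qed

lemma summable_ternary: "summable (\<lambda>k. indicator A k * (2 / 3 ^ Suc k) :: real)"
  by (rule summable_comparison_test'[OF sums_summable[OF sums_ternary_tail[of 0, simplified]], of 0])
    (auto simp: indicator_def)

lemma ternary_code_bounds: "0 \<le> ternary_code A" "ternary_code A \<le> 1"
proof -
  show "0 \<le> ternary_code A"
    unfolding ternary_code_def by (intro suminf_nonneg summable_ternary) simp
  have "ternary_code A \<le> (\<Sum>i. 2 / 3 ^ Suc (i + 0))"
    unfolding ternary_code_def
    by (intro suminf_le summable_ternary sums_summable[OF sums_ternary_tail]) (auto simp: indicator_def)
  then show "ternary_code A \<le> 1" using sums_unique[OF sums_ternary_tail[of 0]] by simp
qed

text \<open>The first differing digit gains \<open>2 / 3 ^ Suc k\<close>, and all later digits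
  together lose at most \<open>1 / 3 ^ Suc k\<close>.\<close>

lemma ternary_code_first_difference:
  assumes k: "k \<in> A" "k \<notin> B" and agree: "\<And>i. i < k \<Longrightarrow> i \<in> A \<longleftrightarrow> i \<in> B"
  shows "1 / 3 ^ Suc k \<le> ternary_code A - ternary_code B"
proof -
  define f :: "nat \<Rightarrow> real" where "f i = indicator A i * (2 / 3 ^ Suc i) - indicator B i * (2 / 3 ^ Suc i)" for i
  have sf: "summable f" unfolding f_def by (intro summable_diff summable_ternary)
  have "ternary_code A - ternary_code B = suminf f"
    unfolding ternary_code_def f_def by (intro suminf_diff summable_ternary)
  also have "\<dots> = (\<Sum>i. f (i + Suc k)) + (\<Sum>i<Suc k. f i)"
    by (rule suminf_split_initial_segment[OF sf])
  also have "(\<Sum>i<Suc k. f i) = 2 / 3 ^ Suc k"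
    using k agree by (simp add: f_def indicator_def)
  finally have eq: "ternary_code A - ternary_code B = (\<Sum>i. f (i + Suc k)) + 2 / 3 ^ Suc k" .
  have "- (1 / 3 ^ Suc k) \<le> (\<Sum>i. f (i + Suc k))"
  proof -
    have s: "(\<lambda>i. - (2 / 3 ^ Suc (i + Suc k)) :: real) sums (- (1 / 3 ^ Suc k))"
      by (intro sums_minus sums_ternary_tail)
    have "(\<Sum>i. - (2 / 3 ^ Suc (i + Suc k))) \<le> (\<Sum>i. f (i + Suc k))"
      by (intro suminf_le sums_summable[OF s] summable_ignore_initial_segment sf)
        (auto simp: f_def indicator_def)
    then show ?thesis using sums_unique[OF s] by simp
  qed
  moreover have "(2 :: real) / 3 ^ Suc k = 1 / 3 ^ Suc k + 1 / 3 ^ Suc k" by simp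
  ultimately show ?thesis using eq by linarith
qed

lemma ternary_code_close:
  assumes "\<bar>ternary_code A - ternary_code B\<bar> < 1 / 3 ^ m" "k < m"
  shows "k \<in> A \<longleftrightarrow> k \<in> B"
proof (rule ccontr)
  assume diff: "\<not> ?thesis"
  define j where "j = (LEAST j. (j \<in> A) \<noteq> (j \<in> B))"
  have j: "(j \<in> A) \<noteq> (j \<in> B)" unfolding j_def by (rule LeastI[of _ k]) (use diff in auto)
  have "j \<le> k" unfolding j_def by (rule Least_le) (use diff in auto)
  have "i \<in> A \<longleftrightarrow> i \<in> B" if "i < j" for i using not_less_Least[of i] that unfolding j_def by blast
  then have "1 / 3 ^ Suc j \<le> \<bar>ternary_code A - ternary_code B\<bar>"
    using j ternary_code_first_difference[of j A B] ternary_code_first_difference[of j B A] by fastforce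
  moreover have "1 / 3 ^ m \<le> (1 / 3 ^ Suc j :: real)"
    using \<open>j \<le> k\<close> assms(2) by (intro divide_left_mono power_increasing) auto
  ultimately show False using assms(1) by linarith
qed

text \<open>The ternary digits of the code of \<open>x\<close>, which are \<open>0\<close> or \<open>2\<close>, record which balls around points
  of finite nets contain \<open>x\<close>.\<close>

lemma compact_borel_code:
  assumes "compact (UNIV :: 'a::metric_space set)"
  shows "\<exists>s :: 'a \<Rightarrow> real. s \<in> borel_measurable borel \<and> (\<forall>x. s x \<in> {0..1}) \<and>
    (\<forall>e>0. \<exists>d>0. \<forall>x y. dist (s x) (s y) < d \<longrightarrow> dist x y < e)"
proof -
  obtain X :: "nat \<Rightarrow> 'a set"
    where X: "\<And>n. finite (X n)" "\<And>n x. \<exists>a\<in>X n. dist x a < 1 / real (Suc n)"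
    using compact_finite_nets[OF assms] by blast
  define \<B> where "\<B> = (\<Union>n. (\<lambda>a. ball a (1 / real (Suc n))) ` X n)"
  have c\<B>: "countable \<B>" unfolding \<B>_def using X(1) by (auto intro: countable_finite)
  have ne: "\<B> \<noteq> {}" unfolding \<B>_def using X(2)[of 0] by blast
  define b where "b = from_nat_into \<B>"
  have ob: "open (b k)" for k
    using from_nat_into[OF ne, of k] by (auto simp: b_def \<B>_def)
  define s where "s x = ternary_code {k. x \<in> b k}" for x
  show ?thesis
  proof (intro exI[of _ s] conjI allI impI)
    have "s x = (\<Sum>k. indicator (b k) x * (2 / 3 ^ Suc k))" for x
      unfolding s_def ternary_code_def by (intro suminf_cong) (simp add: indicator_def)
    then have "s = (\<lambda>x. \<Sum>k. indicator (b k) x * (2 / 3 ^ Suc k))" by (rule ext)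
    then show "s \<in> borel_measurable borel" using ob by simp
    show "s x \<in> {0..1}" for x using ternary_code_bounds by (simp add: s_def)
    fix e :: real assume "e > 0"
    then obtain n where n: "1 / real (Suc n) < e / 2" using nat_approx_posE[of "e / 2"] by auto
    \<comment> \<open>The finitely many balls of level n have indices below m, so codes closer than
      \<open>1 / 3 ^ m\<close> agree on all of them. A ball of this level that contains
      \<open>x\<close> then contains \<open>y\<close>, and its radius is below e / 2.\<close>
    define I where "I = (\<lambda>a. to_nat_on \<B> (ball a (1 / real (Suc n)))) ` X n"
    define m where "m = Suc (Max I)"
    have fI: "finite I" unfolding I_def using X(1) by simp
    have "dist x y < e" if "dist (s x) (s y) < 1 / 3 ^ m" for x y
    proof -
      obtain a where a: "a \<in> X n" "dist x a < 1 / real (Suc n)" using X(2) by blast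
      define k where "k = to_nat_on \<B> (ball a (1 / real (Suc n)))"
      have "k \<in> I" using a(1) by (simp add: k_def I_def)
      then have "k < m" using Max_ge[OF fI] by (auto simp: m_def less_Suc_eq_le)
      have bk: "b k = ball a (1 / real (Suc n))"
        unfolding b_def k_def using a(1) by (intro from_nat_into_to_nat_on c\<B>) (auto simp: \<B>_def)
      have "x \<in> b k \<longleftrightarrow> y \<in> b k"
        using ternary_code_close[of "{k. x \<in> b k}" "{k. y \<in> b k}" m k] that \<open>k < m\<close>
        by (simp add: s_def dist_real_def)
      then have "dist a y < 1 / real (Suc n)" using a(2) by (simp add: bk dist_commute)
      then show ?thesis using dist_triangle[of x y a] a(2) n by linarith
    qed
    then show "\<exists>d>0. \<forall>x y. dist (s x) (s y) < d \<longrightarrow> dist x y < e"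
      by (intro exI[of _ "1 / 3 ^ m"]) auto
  qed
qed

text \<open>Helly selection is applied to the images under the code \<open>s\<close>, which is only
  Borel. Continuity is on the side of the inverse: it extends to the closure \<open>K\<close> of the
  range, so a test function on the space becomes a continuous function on \<open>K\<close> and
  extends to the line by Tietze.\<close>

lemma borel_probs_convergent_subsequence:
  fixes \<mu> :: "nat \<Rightarrow> 'a::polish_space measure"
  assumes cpt: "compact (UNIV :: 'a set)" and \<mu>: "\<And>n. \<mu> n \<in> borel_probs"
  obtains r \<alpha> where "strict_mono (r :: nat \<Rightarrow> nat)" "\<alpha> \<in> borel_probs"
    "\<And>\<phi> :: 'a \<Rightarrow> real. continuous_on UNIV \<phi> \<Longrightarrow> (\<lambda>n. \<integral>x. \<phi> x \<partial>\<mu> (r n)) \<longlonglongrightarrow> (\<integral>x. \<phi> x \<partial>\<alpha>)"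
proof -
  obtain s :: "'a \<Rightarrow> real" where code: "s \<in> borel_measurable borel \<and> (\<forall>x. s x \<in> {0..1}) \<and>
    (\<forall>e>0. \<exists>d>0. \<forall>x y. dist (s x) (s y) < d \<longrightarrow> dist x y < e)"
    using compact_borel_code[OF cpt] by (rule exE)
  then have s: "s \<in> borel_measurable borel" "\<And>x. s x \<in> {0..1}"
    "\<And>e. e > 0 \<Longrightarrow> \<exists>d>0. \<forall>x y. dist (s x) (s y) < d \<longrightarrow> dist x y < e"
    by simp_all
  define K where "K = closure (range s)"
  have sK: "s x \<in> K" for x unfolding K_def by (rule subsetD[OF closure_subset]) simp
  have K: "closed K" "K \<noteq> {}" unfolding K_def by simp_all
  have "inj s"
  proof (rule injI)
    fix x y assume "s x = s y"
    then have "dist x y < e" if "e > 0" for e using s(3)[OF that] by auto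
    then show "x = y" using zero_less_dist_iff[of x y] by fast
  qed
  have uc: "uniformly_continuous_on (range s) (inv s)"
    unfolding uniformly_continuous_on_def
  proof (intro allI impI)
    fix e :: real assume "e > 0"
    then obtain d where "d > 0" "\<And>x y. dist (s x) (s y) < d \<Longrightarrow> dist x y < e" using code by meson
    then show "\<exists>d>0. \<forall>x\<in>range s. \<forall>x'\<in>range s. dist x' x < d \<longrightarrow> dist (inv s x') (inv s x) < e"
      by (intro exI[of _ d]) (auto simp: inv_f_f[OF \<open>inj s\<close>])
  qed
  \<comment> \<open>The limit measure may charge points of \<open>K\<close> outside the range of
    \<open>s\<close>, so the inverse is needed on the whole closure.\<close>
  obtain p where p: "uniformly_continuous_on K p" "\<And>y. y \<in> range s \<Longrightarrow> inv s y = p y"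
    unfolding K_def by (rule uniformly_continuous_on_extension_on_closure[OF uc]) blast
  have ps: "p (s x) = x" for x using p(2)[of "s x"] by (simp add: inv_f_f[OF \<open>inj s\<close>])
  have cp: "continuous_on K p" using p(1) by (rule uniformly_continuous_imp_continuous)
  define \<nu> where "\<nu> n = distr (\<mu> n) borel s" for n
  have sm: "s \<in> borel_measurable (\<mu> n)" for n
    using s(1) \<mu>[of n] by (simp add: borel_probs_def cong: measurable_cong_sets)
  have \<nu>: "real_distribution (\<nu> n)" for n
    unfolding \<nu>_def using \<mu>[of n] sm
    by (intro prob_space.real_distribution_distr) (simp_all add: borel_probs_def)
  have "tight \<nu>"
    unfolding tight_def
  proof (intro conjI allI impI \<nu>)
    fix e :: real assume e: "e > 0"
    \<comment> \<open>Codes lie in [0, 1]; the left end -1 lets the half-open interval contain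
      0.\<close>
    have "measure (\<nu> n) {-1<..1} = 1" for n
    proof -
      interpret prob_space "\<mu> n" using \<mu>[of n] by (simp add: borel_probs_def)
      have "-1 < s x \<and> s x \<le> 1" for x using s(2)[of x] by auto
      then have "s -` {-1<..1} \<inter> space (\<mu> n) = space (\<mu> n)" by auto
      then show ?thesis by (simp add: \<nu>_def measure_distr[OF sm] prob_space)
    qed
    then show "\<exists>a b. a < b \<and> (\<forall>n. measure (\<nu> n) {a<..b} > 1 - e)"
      using e by (intro exI[of _ "-1"] exI[of _ 1]) auto
  qed
  then obtain r M where r: "strict_mono (r :: nat \<Rightarrow> nat)" and M: "real_distribution M"
    and "weak_conv_m (\<nu> \<circ> id \<circ> r) M"
    using tight_imp_convergent_subsubsequence[of \<nu> id] strict_mono_id by blast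
  then have w: "weak_conv_m (\<lambda>n. \<nu> (r n)) M" by (simp add: o_def)
  interpret M: real_distribution M by (rule M)
  have lim: "(\<lambda>n. \<integral>x. f (s x) \<partial>\<mu> (r n)) \<longlonglongrightarrow> (\<integral>y. f y \<partial>M)"
    if f: "continuous_on UNIV f" and B: "\<And>y. norm (f y) \<le> B" for f :: "real \<Rightarrow> real" and B
  proof -
    have "(\<lambda>n. \<integral>y. f y \<partial>\<nu> (r n)) \<longlonglongrightarrow> (\<integral>y. f y \<partial>M)"
      using f by (intro weak_conv_imp_integral_bdd_continuous_conv[OF \<nu> M w _ B])
        (simp add: continuous_on_eq_continuous_at)
    moreover have "(\<integral>y. f y \<partial>\<nu> n) = (\<integral>x. f (s x) \<partial>\<mu> n)" for n
      unfolding \<nu>_def using f by (intro integral_distr sm borel_measurable_continuous_onI)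
    ultimately show ?thesis by simp
  qed
  have inK: "AE y in M. y \<in> K"
  proof -
    \<comment> \<open>This test function vanishes exactly on \<open>K\<close>. Its integral is 0
      along the sequence, hence also in the limit.\<close>
    let ?f = "\<lambda>y. min 1 (infdist y K)"
    have b: "norm (?f y) \<le> 1" for y using infdist_nonneg[of y K] by (simp add: min_def)
    have cf: "continuous_on UNIV ?f" by (intro continuous_intros)
    have "(\<lambda>n. \<integral>x. ?f (s x) \<partial>\<mu> (r n)) \<longlonglongrightarrow> (\<integral>y. ?f y \<partial>M)" by (rule lim[OF cf b])
    moreover have "?f (s x) = 0" for x using sK by simp
    ultimately have "(\<integral>y. ?f y \<partial>M) = 0" by (simp add: LIMSEQ_const_iff)
    moreover have "integrable M ?f"
      using b borel_measurable_continuous_onI[OF cf] by (intro M.integrable_const_bound[of _ 1]) auto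
    ultimately have "AE y in M. ?f y = 0"
      by (subst (asm) integral_nonneg_eq_0_iff_AE) (auto simp: infdist_nonneg)
    then show ?thesis
      by eventually_elim (auto simp: in_closed_iff_infdist_zero[OF K] min_def split: if_splits)
  qed
  \<comment> \<open>A total Borel extension of \<open>p\<close>; the default value occurs only off
    \<open>K\<close>, on a null set of \<open>M\<close>.\<close>
  define q where "q y = (if y \<in> K then p y else undefined)" for y
  have q: "q \<in> borel_measurable M"
    using borel_measurable_continuous_on_if[OF borel_closed[OF K(1)] cp continuous_on_const[of _ undefined]]
    by (simp add: q_def[abs_def])
  define \<alpha> where "\<alpha> = distr M borel q"
  have \<alpha>: "\<alpha> \<in> borel_probs"
    using M.prob_space_distr[OF q] by (simp add: borel_probs_def \<alpha>_def)
  have "(\<lambda>n. \<integral>x. \<phi> x \<partial>\<mu> (r n)) \<longlonglongrightarrow> (\<integral>x. \<phi> x \<partial>\<alpha>)" if \<phi>: "continuous_on UNIV \<phi>" for \<phi> :: "'a \<Rightarrow> real"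
  proof -
    have "bounded (range \<phi>)" using compact_continuous_image[OF \<phi> cpt] compact_imp_bounded by blast
    then obtain B where B: "\<And>x. norm (\<phi> x) \<le> B" unfolding bounded_iff by auto
    have c: "continuous_on K (\<lambda>y. \<phi> (p y))"
      by (rule continuous_on_compose2[OF \<phi> cp]) simp
    have "closedin (top_of_set UNIV) K" using K(1) by simp
    moreover have "0 \<le> B" by (rule order_trans[OF norm_ge_zero B])
    ultimately obtain g where g: "continuous_on UNIV g" "\<And>y. y \<in> K \<Longrightarrow> g y = \<phi> (p y)" "\<And>y. norm (g y) \<le> B"
      by (rule Tietze[OF c _ _ B]) blast
    have m: "\<phi> \<in> borel_measurable borel" "g \<in> borel_measurable borel"
      using \<phi> g(1) by (auto intro: borel_measurable_continuous_onI)
    have "(\<integral>x. \<phi> x \<partial>\<alpha>) = (\<integral>y. \<phi> (q y) \<partial>M)" unfolding \<alpha>_def by (rule integral_distr[OF q m(1)])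
    also have "\<dots> = (\<integral>y. g y \<partial>M)"
    proof (rule integral_cong_AE)
      show "AE y in M. \<phi> (q y) = g y" using inK by eventually_elim (simp add: q_def g(2))
    qed (use measurable_compose[OF q m(1)] m(2) in simp_all)
    finally show ?thesis using lim[OF g(1) g(3)] by (simp only: g(2)[OF sK] ps)
  qed
  then show thesis by (rule that[OF r \<alpha>])
qed

section \<open>Equicontinuity of the dual operator\<close>

lemma limitin_weak_topologyI:
  fixes \<alpha> :: "'a::topological_space measure"
  assumes \<alpha>: "\<alpha> \<in> borel_probs" and \<nu>: "\<And>n. \<nu> n \<in> borel_probs"
    and lim: "\<And>\<phi> :: 'a \<Rightarrow> real. continuous_on UNIV \<phi> \<Longrightarrow> bounded (range \<phi>) \<Longrightarrow>
      ((\<lambda>n. \<integral>x. \<phi> x \<partial>\<nu> n) \<longlongrightarrow> (\<integral>x. \<phi> x \<partial>\<alpha>)) F"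
  shows "limitin weak_topology \<nu> \<alpha> F"
  unfolding limitin_def
proof (intro conjI allI impI)
  show "\<alpha> \<in> topspace weak_topology" using \<alpha> by simp
  fix U assume U: "openin weak_topology U \<and> \<alpha> \<in> U"
  define S :: "'a measure set set" where
    "S = {{\<mu> \<in> borel_probs. (\<integral>x. \<phi> x \<partial>\<mu>) \<in> W} | (\<phi> :: 'a \<Rightarrow> real) W.
        continuous_on UNIV \<phi> \<and> bounded (range \<phi>) \<and> open W}"
  have "generate_topology_on S U"
    using U unfolding weak_topology_def openin_topology_generated_by_iff S_def by simp
  then show "\<forall>\<^sub>F n in F. \<nu> n \<in> U" using conjunct2[OF U]
  proof induction
    case (Int a b)
    then show ?case by (auto intro: eventually_conj)
  next
    case (UN K)
    then obtain k where k: "k \<in> K" "\<alpha> \<in> k" by blast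
    then have "\<forall>\<^sub>F n in F. \<nu> n \<in> k" using UN by blast
    then show ?case by eventually_elim (use k in blast)
  next
    case (Basis s)
    then obtain \<phi> :: "'a \<Rightarrow> real" and W where s: "s = {\<mu> \<in> borel_probs. (\<integral>x. \<phi> x \<partial>\<mu>) \<in> W}"
      and \<phi>: "continuous_on UNIV \<phi>" "bounded (range \<phi>)" and W: "open W" unfolding S_def by blast
    have "\<forall>\<^sub>F n in F. (\<integral>x. \<phi> x \<partial>\<nu> n) \<in> W"
      using Basis(2) s by (intro topological_tendstoD[OF lim[OF \<phi>] W]) simp
    then show ?case using \<nu> by (simp add: s)
  qed simp
qed

lemma limitin_weak_topology_integral:
  fixes \<phi> :: "'a::topological_space \<Rightarrow> real"
  assumes "limitin weak_topology \<nu> \<alpha> F" "continuous_on UNIV \<phi>" "bounded (range \<phi>)"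
  shows "((\<lambda>n. \<integral>x. \<phi> x \<partial>\<nu> n) \<longlongrightarrow> (\<integral>x. \<phi> x \<partial>\<alpha>)) F"
proof (rule topological_tendstoI)
  fix W :: "real set" assume W: "open W" "(\<integral>x. \<phi> x \<partial>\<alpha>) \<in> W"
  have "openin weak_topology {\<mu> \<in> borel_probs. (\<integral>x. \<phi> x \<partial>\<mu>) \<in> W}"
    unfolding weak_topology_def using assms(2,3) W(1)
    by (intro topology_generated_by_Basis) blast
  moreover have "\<alpha> \<in> borel_probs" using assms(1) by (metis limitin_topspace topspace_weak_topology)
  ultimately have "\<forall>\<^sub>F n in F. \<nu> n \<in> {\<mu> \<in> borel_probs. (\<integral>x. \<phi> x \<partial>\<mu>) \<in> W}"
    using assms(1) W(2) unfolding limitin_def by blast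
  then show "\<forall>\<^sub>F n in F. (\<integral>x. \<phi> x \<partial>\<nu> n) \<in> W" by eventually_elim simp
qed

text \<open>A partition of unity subordinate to the balls of equicontinuity reduces the whole family to
  finitely many test functions.\<close>

lemma weak_convergence_uniform_on_equicontinuous:
  fixes f :: "'i \<Rightarrow> 'a::metric_space \<Rightarrow> real"
  assumes cpt: "compact (UNIV :: 'a set)"
    and equi: "\<And>z e. e > 0 \<Longrightarrow> \<exists>d>0. \<forall>n y. dist z y < d \<longrightarrow> \<bar>f n z - f n y\<bar> < e"
    and B: "\<And>n z. \<bar>f n z\<bar> \<le> B"
    and \<mu>: "\<mu> \<in> borel_probs" and \<nu>: "\<And>j. \<nu> j \<in> borel_probs"
    and lim: "\<And>\<phi> :: 'a \<Rightarrow> real. continuous_on UNIV \<phi> \<Longrightarrow>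
      (\<lambda>j. \<integral>x. \<phi> x \<partial>\<nu> j) \<longlonglongrightarrow> (\<integral>x. \<phi> x \<partial>\<mu>)"
  shows "(\<lambda>j. (\<integral>x. f (n j) x \<partial>\<nu> j) - (\<integral>x. f (n j) x \<partial>\<mu>)) \<longlonglongrightarrow> 0"
proof (rule LIMSEQ_I)
  fix e' :: real assume e': "e' > 0"
  \<comment> \<open>Two approximation errors of at most e, and one difference of finite sums below
    e.\<close>
  define e where "e = e' / 3"
  have e: "e > 0" using e' by (simp add: e_def)
  have int: "integrable \<kappa> \<phi>" if "\<kappa> \<in> borel_probs" "continuous_on UNIV \<phi>" for \<kappa> and \<phi> :: "'a \<Rightarrow> real"
    using integrable_borel_probs[OF that] compact_continuous_image[OF that(2) cpt] compact_imp_bounded by blast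
  have cf: "continuous_on UNIV (f k)" for k
    unfolding continuous_on_iff
  proof (intro ballI allI impI)
    fix z and c :: real assume "c > 0"
    from equi[OF this, of z] show "\<exists>d>0. \<forall>y\<in>UNIV. dist y z < d \<longrightarrow> dist (f k y) (f k z) < c"
      by (auto simp: dist_real_def dist_commute abs_minus_commute)
  qed
  obtain d where d: "\<And>z. d z > 0" "\<And>z k y. dist z y < d z \<Longrightarrow> \<bar>f k z - f k y\<bar> < e"
    using equi[OF e] by metis
  obtain X where X: "finite X" "UNIV \<subseteq> (\<Union>a\<in>X. ball a (d a))"
  proof (rule compactE_image[OF cpt, of UNIV "\<lambda>a. ball a (d a)"])
    show "UNIV \<subseteq> (\<Union>a. ball a (d a))" using d(1) centre_in_ball by blast
  qed auto
  define g where "g a x = max 0 (d a - dist a x)" for a x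
  define s where "s x = (\<Sum>a\<in>X. g a x)" for x
  define h where "h a x = g a x / s x" for a x
  have g0: "g a x \<ge> 0" for a x by (simp add: g_def)
  have s0: "s x > 0" for x
  proof -
    have "x \<in> (\<Union>a\<in>X. ball a (d a))" using X(2) by blast
    then obtain a where "a \<in> X" "dist a x < d a" by auto
    then show ?thesis unfolding s_def by (intro sum_pos2[OF X(1)] g0) (auto simp: g_def)
  qed
  have h0: "h a x \<ge> 0" for a x using g0[of a x] s0[of x] by (simp add: h_def)
  have h1: "(\<Sum>a\<in>X. h a x) = 1" for x
    using s0[of x] by (simp add: h_def sum_divide_distrib[symmetric] s_def)
  have "continuous_on UNIV (g b)" for b unfolding g_def by (intro continuous_intros)
  then have ch: "continuous_on UNIV (h a)" for a
    using s0 unfolding h_def s_def by (intro continuous_intros) (auto simp: less_imp_neq[symmetric])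
  have near: "\<bar>f k x - (\<Sum>a\<in>X. f k a * h a x)\<bar> \<le> e" for k x
  proof -
    have "f k x = (\<Sum>a\<in>X. f k x * h a x)" by (simp add: sum_distrib_left[symmetric] h1)
    then have "\<bar>f k x - (\<Sum>a\<in>X. f k a * h a x)\<bar> = \<bar>\<Sum>a\<in>X. (f k x - f k a) * h a x\<bar>"
      by (simp add: left_diff_distrib sum_subtractf)
    also have "\<dots> \<le> (\<Sum>a\<in>X. \<bar>(f k x - f k a) * h a x\<bar>)" by (rule sum_abs)
    also have "\<dots> \<le> (\<Sum>a\<in>X. e * h a x)"
    proof (rule sum_mono)
      fix a
      show "\<bar>(f k x - f k a) * h a x\<bar> \<le> e * h a x"
      proof (cases "dist a x < d a")
        case True
        then show ?thesis
          using d(2)[of a x k] h0[of a x]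
          by (simp add: abs_mult abs_minus_commute mult_right_mono less_imp_le)
      qed (simp add: h_def g_def)
    qed
    also have "\<dots> = e" by (simp add: sum_distrib_left[symmetric] h1)
    finally show ?thesis .
  qed
  have app: "\<bar>(\<integral>x. f k x \<partial>\<kappa>) - (\<Sum>a\<in>X. f k a * (\<integral>x. h a x \<partial>\<kappa>))\<bar> \<le> e" if \<kappa>: "\<kappa> \<in> borel_probs" for k \<kappa>
  proof -
    interpret prob_space \<kappa> using \<kappa> by (simp add: borel_probs_def)
    note ints = int[OF \<kappa> cf] int[OF \<kappa> ch]
    have isum: "integrable \<kappa> (\<lambda>x. \<Sum>a\<in>X. f k a * h a x)" using ints by auto
    have "(\<integral>x. f k x \<partial>\<kappa>) - (\<Sum>a\<in>X. f k a * (\<integral>x. h a x \<partial>\<kappa>)) =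
        (\<integral>x. f k x - (\<Sum>a\<in>X. f k a * h a x) \<partial>\<kappa>)"
      using ints isum by simp
    also have "\<bar>\<dots>\<bar> \<le> (\<integral>x. \<bar>f k x - (\<Sum>a\<in>X. f k a * h a x)\<bar> \<partial>\<kappa>)"
      by (rule integral_abs_bound)
    also have "\<dots> \<le> (\<integral>x. e \<partial>\<kappa>)" using ints isum near by (intro integral_mono) auto
    finally show ?thesis by (simp add: prob_space)
  qed
  \<comment> \<open>\<open>D j\<close> bounds the difference of the finite sums for every index of
    the family, since all coefficients are at most \<open>B\<close> in absolute value; only the
    finitely many fixed functions \<open>h a\<close> are passed to the limit.\<close>
  define D where "D j = (\<Sum>a\<in>X. B * \<bar>(\<integral>x. h a x \<partial>\<nu> j) - (\<integral>x. h a x \<partial>\<mu>)\<bar>)" for j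
  have "(\<lambda>j. \<Sum>a\<in>X. B * \<bar>(\<integral>x. h a x \<partial>\<nu> j) - (\<integral>x. h a x \<partial>\<mu>)\<bar>)
      \<longlonglongrightarrow> (\<Sum>a\<in>X. B * \<bar>(\<integral>x. h a x \<partial>\<mu>) - (\<integral>x. h a x \<partial>\<mu>)\<bar>)"
    by (intro tendsto_intros lim ch)
  then have "D \<longlonglongrightarrow> 0" by (simp add: D_def[abs_def])
  then obtain N where N: "\<And>j. j \<ge> N \<Longrightarrow> \<bar>D j\<bar> < e" using LIMSEQ_D[OF _ e] by fastforce
  have "norm ((\<integral>x. f (n j) x \<partial>\<nu> j) - (\<integral>x. f (n j) x \<partial>\<mu>) - 0) < e'" if "j \<ge> N" for j
  proof -
    let ?S = "\<lambda>\<kappa>. \<Sum>a\<in>X. f (n j) a * (\<integral>x. h a x \<partial>\<kappa>)"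
    have "\<bar>?S (\<nu> j) - ?S \<mu>\<bar> = \<bar>\<Sum>a\<in>X. f (n j) a * ((\<integral>x. h a x \<partial>\<nu> j) - (\<integral>x. h a x \<partial>\<mu>))\<bar>"
      by (simp add: right_diff_distrib sum_subtractf)
    also have "\<dots> \<le> D j"
      unfolding D_def using B by (intro order_trans[OF sum_abs] sum_mono) (simp add: abs_mult mult_right_mono)
    finally have "\<bar>?S (\<nu> j) - ?S \<mu>\<bar> < e" using N[OF that] by simp
    moreover have "e' = 3 * e" by (simp add: e_def)
    ultimately show ?thesis
      using app[OF \<nu>[of j], of "n j"] app[OF \<mu>, of "n j"] unfolding real_norm_def diff_zero by linarith
  qed
  then show "\<exists>N. \<forall>j\<ge>N. norm ((\<integral>x. f (n j) x \<partial>\<nu> j) - (\<integral>x. f (n j) x \<partial>\<mu>) - 0) < e'" by blast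
qed

text \<open>Since \<rho> is an arbitrary compatible metric, closeness of integrals must be
  translated into closeness for \<rho>. Along a subsequence both families of images converge weakly
  to one limit, and weak convergence is convergence for \<rho>.\<close>

lemma equicontinuous_funpow_dual_transition_op:
  assumes \<tau>: "\<tau> \<in> borel_probs" and ker: "kernel_julia_set (semigroup_of \<tau>) = {}"
    and \<rho>: "weak_metric \<rho>"
  shows "equicontinuous_on \<rho> \<rho> borel_probs {dual_transition_op \<tau> ^^ n | n. n \<ge> 1}"
  unfolding equicontinuous_on_def
proof (intro ballI allI impI)
  fix \<mu> :: "csphere measure" and e :: real assume \<mu>: "\<mu> \<in> borel_probs" and e: "e > 0"
  interpret R: Metric_space "borel_probs :: csphere measure set" \<rho> using \<rho> by (simp add: weak_metric_def)
  have top: "R.mtopology = weak_topology" using \<rho> by (simp add: weak_metric_def)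
  \<comment> \<open>Positive powers are written with \<open>Suc\<close> to match the index of
    \<open>expected_value\<close>.\<close>
  let ?T = "\<lambda>n. dual_transition_op \<tau> ^^ Suc n"
  show "\<exists>\<delta>>0. \<forall>f\<in>{dual_transition_op \<tau> ^^ n | n. n \<ge> 1}. \<forall>\<nu>\<in>borel_probs. \<rho> \<mu> \<nu> < \<delta> \<longrightarrow> \<rho> (f \<mu>) (f \<nu>) < e"
  proof (rule ccontr)
    assume contra: "\<not> ?thesis"
    have "\<exists>n \<nu>. \<nu> \<in> borel_probs \<and> \<rho> \<mu> \<nu> < 1 / real (Suc j) \<and> \<not> \<rho> (?T n \<mu>) (?T n \<nu>) < e" for j
    proof -
      have "\<exists>f\<in>{dual_transition_op \<tau> ^^ n | n. n \<ge> 1}. \<exists>\<nu>\<in>borel_probs.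
          \<rho> \<mu> \<nu> < 1 / real (Suc j) \<and> \<not> \<rho> (f \<mu>) (f \<nu>) < e"
      proof (rule ccontr)
        assume "\<not> ?thesis"
        then have "\<forall>f\<in>{dual_transition_op \<tau> ^^ n | n. n \<ge> 1}. \<forall>\<nu>\<in>borel_probs.
            \<rho> \<mu> \<nu> < 1 / real (Suc j) \<longrightarrow> \<rho> (f \<mu>) (f \<nu>) < e" by fast
        moreover have "1 / real (Suc j) > 0" by simp
        ultimately show False using contra by fast
      qed
      then obtain f \<nu> where f: "f \<in> {dual_transition_op \<tau> ^^ n | n. n \<ge> 1}" and \<nu>: "\<nu> \<in> borel_probs"
        "\<rho> \<mu> \<nu> < 1 / real (Suc j)" "\<not> \<rho> (f \<mu>) (f \<nu>) < e" by fast
      obtain m where m: "f = dual_transition_op \<tau> ^^ m" "m \<ge> 1" using f by blast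
      then have "f = ?T (m - 1)" by simp
      then show ?thesis using \<nu> by blast
    qed
    then obtain n \<nu> where \<nu>: "\<And>j. \<nu> j \<in> borel_probs" "\<And>j. \<rho> \<mu> (\<nu> j) < 1 / real (Suc j)"
      and far: "\<And>j. \<not> \<rho> (?T (n j) \<mu>) (?T (n j) (\<nu> j)) < e" by metis
    have "limitin R.mtopology \<nu> \<mu> sequentially"
      unfolding R.limitin_metric
    proof (intro conjI allI impI \<mu>)
      fix c :: real assume "c > 0"
      then obtain j0 where j0: "1 / real (Suc j0) < c" using nat_approx_posE by blast
      have "\<rho> (\<nu> j) \<mu> < c" if "j \<ge> j0" for j
      proof -
        have "1 / real (Suc j) \<le> 1 / real (Suc j0)" using that by (intro divide_left_mono) auto
        then show ?thesis using \<nu>(2)[of j] j0 R.commute[of "\<nu> j" \<mu>] by linarith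
      qed
      then show "\<forall>\<^sub>F j in sequentially. \<nu> j \<in> borel_probs \<and> \<rho> (\<nu> j) \<mu> < c"
        using \<nu>(1) by (auto simp: eventually_sequentially)
    qed
    then have lim\<nu>: "(\<lambda>j. \<integral>x. \<phi> x \<partial>\<nu> j) \<longlonglongrightarrow> (\<integral>x. \<phi> x \<partial>\<mu>)" if "continuous_on UNIV \<phi>" for \<phi> :: "csphere \<Rightarrow> real"
      unfolding top using limitin_weak_topology_integral that bounded_range_continuous_csphere by blast
    define a where "a j = ?T (n j) \<mu>" for j
    define b where "b j = ?T (n j) (\<nu> j)" for j
    have a: "a j \<in> borel_probs" and b: "b j \<in> borel_probs" for j
      using funpow_dual_transition_op_in_borel_probs[OF \<tau>] \<mu> \<nu>(1) unfolding a_def b_def by blast+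
    have ba: "(\<lambda>j. (\<integral>x. \<phi> x \<partial>b j) - (\<integral>x. \<phi> x \<partial>a j)) \<longlonglongrightarrow> 0"
      if \<phi>: "continuous_on UNIV \<phi>" for \<phi> :: "csphere \<Rightarrow> real"
    proof -
      obtain B where B: "\<And>x. \<bar>\<phi> x\<bar> \<le> B"
        using bounded_range_continuous_csphere[OF \<phi>] unfolding bounded_iff by auto
      show ?thesis
        unfolding a_def b_def integral_funpow_dual_transition_op[OF \<tau> \<nu>(1) \<phi>]
          integral_funpow_dual_transition_op[OF \<tau> \<mu> \<phi>]
        by (rule weak_convergence_uniform_on_equicontinuous[OF compact_csphere
              expected_value_equicontinuous[OF \<tau> ker \<phi>] abs_expected_value_le[OF \<tau> B] \<mu> \<nu>(1) lim\<nu>])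
    qed
    obtain r \<alpha> where r: "strict_mono (r :: nat \<Rightarrow> nat)" and \<alpha>: "\<alpha> \<in> borel_probs"
      and lima: "\<And>\<phi> :: csphere \<Rightarrow> real. continuous_on UNIV \<phi> \<Longrightarrow> (\<lambda>j. \<integral>x. \<phi> x \<partial>a (r j)) \<longlonglongrightarrow> (\<integral>x. \<phi> x \<partial>\<alpha>)"
      by (rule borel_probs_convergent_subsequence[of a, OF compact_csphere a]) blast
    \<comment> \<open>By \<open>ba\<close> the integrals of the two sequences differ by a null
      sequence, so the limit found for \<open>a\<close> also serves for \<open>b\<close>.\<close>
    have "(\<lambda>j. \<integral>x. \<phi> x \<partial>b (r j)) \<longlonglongrightarrow> (\<integral>x. \<phi> x \<partial>\<alpha>)" if \<phi>: "continuous_on UNIV \<phi>" for \<phi> :: "csphere \<Rightarrow> real"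
      using tendsto_add[OF LIMSEQ_subseq_LIMSEQ[OF ba[OF \<phi>] r] lima[OF \<phi>]] by (simp add: o_def)
    then have "limitin R.mtopology (\<lambda>j. a (r j)) \<alpha> sequentially" "limitin R.mtopology (\<lambda>j. b (r j)) \<alpha> sequentially"
      unfolding top using lima by (auto intro!: limitin_weak_topologyI \<alpha> a b)
    then have "\<forall>\<^sub>F j in sequentially. a (r j) \<in> borel_probs \<and> \<rho> (a (r j)) \<alpha> < e / 2"
      "\<forall>\<^sub>F j in sequentially. b (r j) \<in> borel_probs \<and> \<rho> (b (r j)) \<alpha> < e / 2"
      using half_gt_zero[OF e] unfolding R.limitin_metric by blast+
    then have "\<forall>\<^sub>F j in sequentially. False"
    proof eventually_elim
      case (elim j)
      have "\<rho> (a (r j)) (b (r j)) \<le> \<rho> (a (r j)) \<alpha> + \<rho> \<alpha> (b (r j))" by (rule R.triangle[OF a \<alpha> b])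
      then have "\<rho> (a (r j)) (b (r j)) < e" using elim R.commute[of \<alpha> "b (r j)"] by simp
      then show ?case using far[of "r j"] unfolding a_def b_def by blast
    qed
    then show False by simp
  qed
qed

theorem theorem1p5:
  fixes \<tau> :: "ratmap measure"
  assumes "\<tau> \<in> compact_borel_probs"
    and "kernel_julia_set (semigroup_of \<tau>) = {}"
  shows "(\<forall>\<rho>. weak_metric \<rho> \<longrightarrow> julia_meas \<rho> \<tau> = {}) \<and>
    (AE \<gamma> in seq_measure \<tau>. random_julia_set \<gamma> \<in> null_sets sphere_lebesgue)"
proof (intro conjI allI impI)
  have \<tau>: "\<tau> \<in> borel_probs" using assms(1) by (simp add: compact_borel_probs_def)
  show "AE \<gamma> in seq_measure \<tau>. random_julia_set \<gamma> \<in> null_sets sphere_lebesgue"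
    by (rule AE_random_julia_set_null[OF \<tau> assms(2)])
  fix \<rho> assume "weak_metric \<rho>"
  then have "equicontinuous_on \<rho> \<rho> borel_probs {dual_transition_op \<tau> ^^ n | n. n \<ge> 1}"
    by (rule equicontinuous_funpow_dual_transition_op[OF \<tau> assms(2)])
  \<comment> \<open>The whole space serves as the neighborhood \<open>B\<close> for every measure at
    once.\<close>
  moreover have "openin weak_topology (borel_probs :: csphere measure set)"
    using openin_topspace[of "weak_topology :: csphere measure topology"] by simp
  ultimately show "julia_meas \<rho> \<tau> = {}" unfolding julia_meas_def by blast
qed

end
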